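(* Consider the fourth order finite difference scheme in two dimensions, $$\mathcal M_{i,j}g^{n+1}_{i,j}+\Delta t\,(\mathcal X g^{n+1})_{i,j}+\Delta t\,(\mathcal Y g^{n+1})_{i,j}=\mathcal M_{i,j}g^n_{i,j},\qquad 1\le i,j\le N,$$ with $\mathcal X,\mathcal Y$ defined in the context. For each grid point $(i,j)$ let $E_\Delta=[i-2,i+2]\times[j-2,j+2]$ denote the block of grid points (and the corresponding closed square of the domain) around $(i,j)$. Suppose that: (a) for odd $i$ and odd $j$, $$\mathcal M_{i,j}+\Delta t\frac{-u_{i-2,j}+4u_{i-1,j}-4u_{i+1,j}+u_{i+2,j}}{4h}+\Delta t\frac{-v_{i,j-2}+4v_{i,j-1}-4v_{i,j+1}+v_{i,j+2}}{4h}>0;$$ for odd $i$ and even $j$, $$\mathcal M_{i,j}+\Delta t\frac{D(\mathcal M_{i,j-1}+\mathcal M_{i,j+1})}{h^2}+\Delta t\frac{-u_{i-2,j}+4u_{i-1,j}-4u_{i+1,j}+u_{i+2,j}}{4h}>0;$$ for even $i$ and odd $j$, $$\mathcal M_{i,j}+\Delta t\frac{D(\mathcal M_{i-1,j}+\mathcal M_{i+1,j})}{h^2}+\Delta t\frac{-v_{i,j-2}+4v_{i,j-1}-4v_{i,j+1}+v_{i,j+2}}{4h}>0;$$ (b) $h\max_{E_\Delta}|\vec u_{i,j}|\le\frac1{20}D\min_{E_\Delta}\{\mathcal M_{i,j}\}$ for every $E_\Delta$; (c) $h\max_{E_\Delta}|(\partial_x\mathcal M,\partial_y\mathcal M)|\le\frac{\sqrt2}{320}\min_{E_\Delta}\{\mathcal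 M_{i,j}\}$ for every $E_\Delta$; (d) $\dfrac{\Delta t}{h^2}\ge\dfrac1{\sqrt2\,D}$. Then the coefficient matrix for the unknown vector $\vec g^{\,n+1}$ satisfies Lorenz's conditions, so it is a product of two M-matrices and thus monotone. In particular, if the velocity field satisfies the discrete divergence free constraint for odd $i$, odd $j$: $\frac{-u_{i-2,j}+4u_{i-1,j}-4u_{i+1,j}+u_{i+2,j}}{4h}+\frac{-v_{i,j-2}+4v_{i,j-1}-4v_{i,j+1}+v_{i,j+2}}{4h}=0$; for odd $i$, even $j$: $\frac{-u_{i-2,j}+4u_{i-1,j}-4u_{i+1,j}+u_{i+2,j}}{4h}+\frac{v_{i,j-1}-v_{i,j+1}}{2h}=0$; for even $i$, odd $j$: $\frac{u_{i-1,j}-u_{i+1,j}}{2h}+\frac{-v_{i,j-2}+4v_{i,j-1}-4v_{i,j+1}+v_{i,j+2}}{4h}=0$; for even $i$, even $j$: $\frac{u_{i-1,j}-u_{i+1,j}}{2h}+\frac{v_{i,j-1}-v_{i,j+1}}{2h}=0$, then the coefficient matrix is monotone under the constraints (b), (c) and (d) alone.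
   Context: $\Omega=[-L,L]^2$ is partitioned into $k\times k$ ($k\ge1$) square cells of side $2h$; the grid points $(x_i,y_j)$, $1\le i,j\le N=2k+1$, form a uniform grid with spacing $h$. $D>0$ is a constant, $\Delta t>0$. $\mathcal M\in C^1(\bar\Omega)$ is a given function with $\mathcal M\ge\epsilon_0>0$, $\mathcal M_{i,j}=\mathcal M(x_i,y_j)$; $\vec u_{i,j}=(u_{i,j},v_{i,j})$ are point values of a given velocity field with $\vec u\cdot\vec n=0$ on the boundary, i.e. $u_{1,j}=u_{N,j}=0$, $v_{i,1}=v_{i,N}=0$. Ghost values: $g$ and $\mathcal M$ are extended evenly across each side ($g_{0,j}:=g_{2,j}$, $g_{-1,j}:=g_{3,j}$, $g_{N+1,j}:=g_{N-1,j}$, $g_{N+2,j}:=g_{N-2,j}$, similarly in $j$ and for $\mathcal M$), and the normal velocity oddly ($u_{0,j}:=-u_{2,j}$, $u_{-1,j}:=-u_{3,j}$, $u_{N+1,j}:=-u_{N-1,j}$, $u_{N+2,j}:=-u_{N-2,j}$, and similarly for $v$ in the index $j$); substituting these makes the scheme an $N^2\times N^2$ linear system. In (b), (c), blocks $E_\Delta$ reaching outside the grid are intersected with it (and with $\bar\Omega$); $|\cdot|$ is the Euclidean norm. Operators: if $i$ is odd, $$\begin{aligned}(\mathcal Xg)_{i,j}=&\frac{-u_{i-2,j}g_{i-2,j}+4u_{i-1,j}g_{i-1,j}-4u_{i+1,j}g_{i+1,j}+u_{i+2,j}g_{i+2,j}}{4h}\\&+\frac D{8h^2}\Big[(3\mathcal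 M_{i-2,j}-4\mathcal M_{i-1,j}+3\mathcal M_{i,j})g_{i-2,j}-(4\mathcal M_{i-2,j}+12\mathcal M_{i,j})g_{i-1,j}\\&+(\mathcal M_{i-2,j}+4\mathcal M_{i-1,j}+18\mathcal M_{i,j}+4\mathcal M_{i+1,j}+\mathcal M_{i+2,j})g_{i,j}\\&-(12\mathcal M_{i,j}+4\mathcal M_{i+2,j})g_{i+1,j}+(3\mathcal M_{i,j}-4\mathcal M_{i+1,j}+3\mathcal M_{i+2,j})g_{i+2,j}\Big];\end{aligned}$$ if $i$ is even, $$(\mathcal Xg)_{i,j}=\frac{u_{i-1,j}g_{i-1,j}-u_{i+1,j}g_{i+1,j}}{2h}+\frac D{4h^2}\Big[-(3\mathcal M_{i-1,j}+\mathcal M_{i+1,j})g_{i-1,j}+4(\mathcal M_{i-1,j}+\mathcal M_{i+1,j})g_{i,j}-(\mathcal M_{i-1,j}+3\mathcal M_{i+1,j})g_{i+1,j}\Big].$$ $(\mathcal Yg)_{i,j}$ is defined by the same formulas in the $j$ direction: with $v$ in place of $u$, shifts in $j$ in place of shifts in $i$, and the parity of $j$ in place of the parity of $i$. Matrix inequalities are entrywise. A square matrix is monotone if it is invertible with entrywise nonnegative inverse. A (nonsingular) M-matrix is a matrix $sI-B$ with $B\ge0$ and $s$ greater than the spectral radius of $B$. Lorenz's conditions for $A=(a_{ij})\in\mathbb R^{m\times m}$: let $A_d$ be the diagonal part of $A$, $A_a^+$ the matrix of positive off-diagonal entries, $A_a^-=A-A_d-A_a^+$. There is a decomposition $A_a^-=A^z+A^s$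 with $A^z\le0$, $A^s\le0$ such that (1) $A_d+A^z$ is a nonsingular M-matrix; (2) $A_a^+\le A^zA_d^{-1}A^s$; (3) there is a nonzero vector $\vec e\ge0$ with $A\vec e\ge0$ such that $A^z$ or $A^s$ connects $\mathcal N^0=\{i:(A\vec e)_i=0\}$ with $\mathcal N^+=\{i:(A\vec e)_i>0\}$. Here a matrix $C=(c_{ij})$ connects $\mathcal N_1$ with $\mathcal N_2$ if for every $i_0\in\mathcal N_1$ there exist $i_r\in\mathcal N_2$ and indices $i_1,\dots,i_{r-1}$ with $c_{i_{k-1}i_k}\ne0$ for $k=1,\dots,r$ (vacuously true if $\mathcal N_1=\emptyset$). *)

theory Defs
  imports "HOL-Analysis.Product_Vector" "Jordan_Normal_Form.Spectral_Radius"
begin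

section \<open>Monotone matrices, M-matrices and Lorenz's conditions\<close>

definition nonneg_mat :: "real mat \<Rightarrow> bool" where
  "nonneg_mat A \<longleftrightarrow> 0\<^sub>m (dim_row A) (dim_col A) \<le> A"

definition nonpos_mat :: "real mat \<Rightarrow> bool" where
  "nonpos_mat A \<longleftrightarrow> A \<le> 0\<^sub>m (dim_row A) (dim_col A)"

definition is_inverse_mat :: "real mat \<Rightarrow> real mat \<Rightarrow> bool" where
  "is_inverse_mat A B \<longleftrightarrow>
     square_mat A \<and> B \<in> carrier_mat (dim_row A) (dim_row A) \<and> inverts_mat A B \<and> inverts_mat B A"

definition monotone_mat :: "real mat \<Rightarrow> bool" where
  "monotone_mat A \<longleftrightarrow> (\<exists>B. is_inverse_mat A B \<and> nonneg_mat B)"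

definition M_matrix :: "real mat \<Rightarrow> bool" where
  "M_matrix A \<longleftrightarrow> square_mat A \<and>
     (\<exists>s B. B \<in> carrier_mat (dim_row A) (dim_row A) \<and> nonneg_mat B
        \<and> spectral_radius (map_mat complex_of_real B) < s
        \<and> A = s \<cdot>\<^sub>m 1\<^sub>m (dim_row A) - B)"

definition diag_part :: "real mat \<Rightarrow> real mat" where
  "diag_part A = mat (dim_row A) (dim_col A) (\<lambda>(p, q). if p = q then A $$ (p, q) else 0)"

definition pos_offdiag :: "real mat \<Rightarrow> real mat" where
  "pos_offdiag A = mat (dim_row A) (dim_col A)
     (\<lambda>(p, q). if p \<noteq> q \<and> A $$ (p, q) > 0 then A $$ (p, q) else 0)"

definition neg_offdiag :: "real mat \<Rightarrow> real mat" where
  "neg_offdiag A = A - diag_part A - pos_offdiag A"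

definition connects :: "real mat \<Rightarrow> nat set \<Rightarrow> nat set \<Rightarrow> bool" where
  "connects C S T \<longleftrightarrow> (\<forall>p\<in>S. \<exists>q\<in>T.
     (p, q) \<in> {(a, b). a < dim_row C \<and> b < dim_col C \<and> C $$ (a, b) \<noteq> 0}\<^sup>+)"

definition lorenz_conditions :: "real mat \<Rightarrow> bool" where
  "lorenz_conditions A \<longleftrightarrow> square_mat A \<and>
     (\<exists>Az As. Az \<in> carrier_mat (dim_row A) (dim_row A) \<and> As \<in> carrier_mat (dim_row A) (dim_row A)
        \<and> neg_offdiag A = Az + As \<and> nonpos_mat Az \<and> nonpos_mat As
        \<and> M_matrix (diag_part A + Az)
        \<and> (\<exists>Dinv. is_inverse_mat (diag_part A) Dinv \<and> pos_offdiag A \<le> Az * Dinv * As)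
        \<and> (\<exists>e \<in> carrier_vec (dim_row A). e \<noteq> 0\<^sub>v (dim_row A) \<and> 0\<^sub>v (dim_row A) \<le> e
             \<and> 0\<^sub>v (dim_row A) \<le> A *\<^sub>v e
             \<and> (let N0 = {p. p < dim_row A \<and> (A *\<^sub>v e) $ p = 0};
                    Np = {p. p < dim_row A \<and> (A *\<^sub>v e) $ p > 0}
                in connects Az N0 Np \<or> connects As N0 Np)))"

section \<open>Grid, ghost values and data\<close>

definition dom_square :: "real \<Rightarrow> (real \<times> real) set" where
  "dom_square L = {-L..L} \<times> {-L..L}"

text \<open>\<^term>\<open>fx\<close> and \<^term>\<open>fy\<close> are the partial derivatives of \<^term>\<open>f\<close> (one-sided in the normal
  direction on the boundary), and they are continuous up to the boundary. On the square this is
  the same as \<^term>\<open>f\<close> being continuously differentiable inside with first derivatives (and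
  \<^term>\<open>f\<close> itself) extending continuously to the closure.\<close>

definition C1_closed_square ::
  "real \<Rightarrow> (real \<times> real \<Rightarrow> real) \<Rightarrow> (real \<times> real \<Rightarrow> real) \<Rightarrow> (real \<times> real \<Rightarrow> real) \<Rightarrow> bool" where
  "C1_closed_square L f fx fy \<longleftrightarrow>
     (\<forall>x\<in>{-L..L}. \<forall>y\<in>{-L..L}.
        ((\<lambda>s. f (s, y)) has_real_derivative fx (x, y)) (at x within {-L..L}) \<and>
        ((\<lambda>t. f (x, t)) has_real_derivative fy (x, y)) (at y within {-L..L}))
     \<and> continuous_on (dom_square L) fx \<and> continuous_on (dom_square L) fy"

definition grid_coord :: "real \<Rightarrow> real \<Rightarrow> int \<Rightarrow> real" where
  "grid_coord L h i = - L + (of_int i - 1) * h"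

definition grid_point :: "real \<Rightarrow> real \<Rightarrow> int \<Rightarrow> int \<Rightarrow> real \<times> real" where
  "grid_point L h i j = (grid_coord L h i, grid_coord L h j)"

text \<open>The block of grid points around \<open>(i, j)\<close> and the closed square it spans, each cut off at the
  boundary.\<close>

definition grid_block :: "nat \<Rightarrow> int \<Rightarrow> int \<Rightarrow> (int \<times> int) set" where
  "grid_block N i j = ({i-2..i+2} \<times> {j-2..j+2}) \<inter> ({1..int N} \<times> {1..int N})"

definition closed_block :: "real \<Rightarrow> real \<Rightarrow> int \<Rightarrow> int \<Rightarrow> (real \<times> real) set" where
  "closed_block L h i j =
     ({grid_coord L h (i-2)..grid_coord L h (i+2)} \<times> {grid_coord L h (j-2)..grid_coord L h (j+2)})
       \<inter> dom_square L"

text \<open>Reflection of the ghost indices \<open>-1, 0\<close> and \<open>N+1, N+2\<close> about the boundary indices \<open>1\<close> and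
  \<open>N\<close>: \<open>0 \<mapsto> 2\<close>, \<open>-1 \<mapsto> 3\<close>, \<open>N+1 \<mapsto> N-1\<close>, \<open>N+2 \<mapsto> N-2\<close>.\<close>

definition reflect :: "nat \<Rightarrow> int \<Rightarrow> int" where
  "reflect N i = (if i < 1 then 2 - i else if i > int N then 2 * int N - i else i)"

definition even_ext :: "nat \<Rightarrow> (int \<Rightarrow> int \<Rightarrow> real) \<Rightarrow> int \<Rightarrow> int \<Rightarrow> real" where
  "even_ext N g i j = g (reflect N i) (reflect N j)"

definition odd_ext :: "nat \<Rightarrow> (int \<Rightarrow> real) \<Rightarrow> int \<Rightarrow> real" where
  "odd_ext N w i = (if 1 \<le> i \<and> i \<le> int N then w i else - w (reflect N i))"

section \<open>The scheme\<close>

definition conv_odd :: "real \<Rightarrow> (int \<Rightarrow> real) \<Rightarrow> int \<Rightarrow> real" where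
  "conv_odd h w i = (- w (i-2) + 4 * w (i-1) - 4 * w (i+1) + w (i+2)) / (4 * h)"

definition conv_even :: "real \<Rightarrow> (int \<Rightarrow> real) \<Rightarrow> int \<Rightarrow> real" where
  "conv_even h w i = (w (i-1) - w (i+1)) / (2 * h)"

definition stencil ::
  "real \<Rightarrow> real \<Rightarrow> (int \<Rightarrow> real) \<Rightarrow> (int \<Rightarrow> real) \<Rightarrow> (int \<Rightarrow> real) \<Rightarrow> int \<Rightarrow> real" where
  "stencil h D M w g i =
     (if odd i then
        conv_odd h (\<lambda>a. w a * g a) i
        + D / (8 * h^2) *
          ((3 * M (i-2) - 4 * M (i-1) + 3 * M i) * g (i-2)
           - (4 * M (i-2) + 12 * M i) * g (i-1)
           + (M (i-2) + 4 * M (i-1) + 18 * M i + 4 * M (i+1) + M (i+2)) * g i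
           - (12 * M i + 4 * M (i+2)) * g (i+1)
           + (3 * M i - 4 * M (i+1) + 3 * M (i+2)) * g (i+2))
      else
        conv_even h (\<lambda>a. w a * g a) i
        + D / (4 * h^2) *
          (- (3 * M (i-1) + M (i+1)) * g (i-1)
           + 4 * (M (i-1) + M (i+1)) * g i
           - (M (i-1) + 3 * M (i+1)) * g (i+1)))"

definition X_op ::
  "real \<Rightarrow> real \<Rightarrow> (int \<Rightarrow> int \<Rightarrow> real) \<Rightarrow> (int \<Rightarrow> int \<Rightarrow> real) \<Rightarrow> (int \<Rightarrow> int \<Rightarrow> real) \<Rightarrow> int \<Rightarrow> int \<Rightarrow> real" where
  "X_op h D M u g i j = stencil h D (\<lambda>a. M a j) (\<lambda>a. u a j) (\<lambda>a. g a j) i"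

definition Y_op ::
  "real \<Rightarrow> real \<Rightarrow> (int \<Rightarrow> int \<Rightarrow> real) \<Rightarrow> (int \<Rightarrow> int \<Rightarrow> real) \<Rightarrow> (int \<Rightarrow> int \<Rightarrow> real) \<Rightarrow> int \<Rightarrow> int \<Rightarrow> real" where
  "Y_op h D M v g i j = stencil h D (\<lambda>b. M i b) (\<lambda>b. v i b) (\<lambda>b. g i b) j"

text \<open>Left-hand side of the scheme. \<^term>\<open>M\<close>, \<^term>\<open>u\<close>, \<^term>\<open>v\<close> already carry their ghost values;
  only the values of the unknown \<^term>\<open>g\<close> with indices in \<open>1..N\<close> enter.\<close>

definition scheme_lhs ::
  "nat \<Rightarrow> real \<Rightarrow> real \<Rightarrow> real \<Rightarrow> (int \<Rightarrow> int \<Rightarrow> real) \<Rightarrow> (int \<Rightarrow> int \<Rightarrow> real) \<Rightarrow> (int \<Rightarrow> int \<Rightarrow> real)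
    \<Rightarrow> (int \<Rightarrow> int \<Rightarrow> real) \<Rightarrow> int \<Rightarrow> int \<Rightarrow> real" where
  "scheme_lhs N h D \<Delta>t M u v g i j =
     M i j * g i j + \<Delta>t * X_op h D M u (even_ext N g) i j + \<Delta>t * Y_op h D M v (even_ext N g) i j"

text \<open>Row-by-row numbering of the \<open>N\<^sup>2\<close> grid points by \<open>0, \<dots>, N\<^sup>2 - 1\<close>.\<close>

definition idx :: "nat \<Rightarrow> nat \<Rightarrow> int \<times> int" where
  "idx N p = (int (p div N) + 1, int (p mod N) + 1)"

definition grid_vec :: "nat \<Rightarrow> (int \<Rightarrow> int \<Rightarrow> real) \<Rightarrow> real vec" where
  "grid_vec N g = vec (N * N) (\<lambda>p. case idx N p of (i, j) \<Rightarrow> g i j)"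

definition unit_grid :: "nat \<Rightarrow> nat \<Rightarrow> int \<Rightarrow> int \<Rightarrow> real" where
  "unit_grid N q i j = (if (i, j) = idx N q then 1 else 0)"

text \<open>Column \<open>q\<close> is the left-hand side applied to the \<open>q\<close>-th unit grid function; see
  \<open>scheme_iff_coeff_mat\<close> below.\<close>

definition coeff_mat ::
  "nat \<Rightarrow> real \<Rightarrow> real \<Rightarrow> real \<Rightarrow> (int \<Rightarrow> int \<Rightarrow> real) \<Rightarrow> (int \<Rightarrow> int \<Rightarrow> real) \<Rightarrow> (int \<Rightarrow> int \<Rightarrow> real)
    \<Rightarrow> real mat" where
  "coeff_mat N h D \<Delta>t M u v = mat (N * N) (N * N)
     (\<lambda>(p, q). case idx N p of (i, j) \<Rightarrow> scheme_lhs N h D \<Delta>t M u v (unit_grid N q) i j)"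

lemma stencil_sum:
  assumes "finite Q"
  shows "stencil h D M w (\<lambda>a. \<Sum>q\<in>Q. c q * G q a) i = (\<Sum>q\<in>Q. c q * stencil h D M w (G q) i)"
  using assms
proof (induction Q rule: finite_induct)
  case empty
  show ?case by (simp add: stencil_def conv_odd_def conv_even_def)
next
  case (insert q Q)
  have lin: "stencil h D M w (\<lambda>a. c * f a + g a) i = c * stencil h D M w f i + stencil h D M w g i"
    for c f g
  proof -
    have co: "conv_odd h (\<lambda>a. w a * (c * f a + g a)) i
        = c * conv_odd h (\<lambda>a. w a * f a) i + conv_odd h (\<lambda>a. w a * g a) i"
      unfolding conv_odd_def times_divide_eq_right add_divide_distrib[symmetric]
      by (rule arg_cong[where f = "\<lambda>z. z / (4 * h)"]) (simp add: algebra_simps)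
    have ce: "conv_even h (\<lambda>a. w a * (c * f a + g a)) i
        = c * conv_even h (\<lambda>a. w a * f a) i + conv_even h (\<lambda>a. w a * g a) i"
      unfolding conv_even_def times_divide_eq_right add_divide_distrib[symmetric]
      by (rule arg_cong[where f = "\<lambda>z. z / (2 * h)"]) (simp add: algebra_simps)
    have kk: "c * P + Q + K * (c * S + T) = c * (P + K * S) + (Q + K * T)" for P Q K S T :: real
      by (simp add: algebra_simps)
    have l5: "A * (c * f1 + g1) - B * (c * f2 + g2) + C * (c * f3 + g3)
          - E * (c * f4 + g4) + F * (c * f5 + g5)
        = c * (A * f1 - B * f2 + C * f3 - E * f4 + F * f5)
          + (A * g1 - B * g2 + C * g3 - E * g4 + F * g5)"
      for A B C E F f1 f2 f3 f4 f5 g1 g2 g3 g4 g5 :: real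
      unfolding distrib_left right_diff_distrib mult.left_commute[of _ c] by linarith
    have l3: "A * (c * f1 + g1) + B * (c * f2 + g2) - C * (c * f3 + g3)
        = c * (A * f1 + B * f2 - C * f3) + (A * g1 + B * g2 - C * g3)"
      for A B C f1 f2 f3 g1 g2 g3 :: real
      unfolding distrib_left right_diff_distrib mult.left_commute[of _ c] by linarith
    show ?thesis
    proof (cases "odd i")
      case True
      show ?thesis unfolding stencil_def co if_P[OF True] l5 by (rule kk)
    next
      case False
      show ?thesis unfolding stencil_def ce if_not_P[OF False] l3 by (rule kk)
    qed
  qed
  show ?case using insert lin[of "c q" "G q" "\<lambda>a. \<Sum>q\<in>Q. c q * G q a"] by simp
qed

lemma grid_expand:
  assumes "1 \<le> i" "i \<le> int N" "1 \<le> j" "j \<le> int N"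
  shows "g i j = (\<Sum>q<N * N. grid_vec N g $ q * unit_grid N q i j)"
proof -
  define r where "r = nat (i - 1) * N + nat (j - 1)"
  have a: "nat (i - 1) < N" "nat (j - 1) < N" using assms by auto
  have "nat (i - 1) * N + nat (j - 1) < (nat (i - 1) + 1) * N" using a by simp
  also have "\<dots> \<le> N * N" using a by (intro mult_le_mono1) auto
  finally have r: "r < N * N" unfolding r_def .
  have ir: "idx N r = (i, j)" using a assms by (simp add: idx_def r_def)
  have inj: "q = r" if "idx N q = (i, j)" for q
  proof -
    have "q div N = r div N" "q mod N = r mod N" using that ir by (auto simp: idx_def)
    then show ?thesis by (metis div_mult_mod_eq)
  qed
  have "(\<Sum>q<N * N. grid_vec N g $ q * unit_grid N q i j)
      = (\<Sum>q<N * N. if q = r then grid_vec N g $ q else 0)"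
  proof (rule sum.cong[OF refl])
    fix q
    have "(i, j) = idx N q \<longleftrightarrow> q = r" using inj[of q] ir by metis
    then show "grid_vec N g $ q * unit_grid N q i j = (if q = r then grid_vec N g $ q else 0)"
      unfolding unit_grid_def by simp
  qed
  also have "\<dots> = g i j" using r ir by (simp add: grid_vec_def)
  finally show ?thesis by simp
qed

lemma stencil_cong:
  assumes "\<And>a. i - 2 \<le> a \<Longrightarrow> a \<le> i + 2 \<Longrightarrow> f a = g a"
  shows "stencil h D M w f i = stencil h D M w g i"
  using assms by (simp add: stencil_def conv_odd_def conv_even_def)

lemma scheme_iff_coeff_mat:
  assumes "N \<ge> 3"
  shows "(\<forall>i\<in>{1..int N}. \<forall>j\<in>{1..int N}. scheme_lhs N h D \<Delta>t M u v g i j = M i j * g0 i j)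
    \<longleftrightarrow> coeff_mat N h D \<Delta>t M u v *\<^sub>v grid_vec N g = grid_vec N (\<lambda>i j. M i j * g0 i j)"
proof -
  let ?c = "\<lambda>q. grid_vec N g $ q"
  have lin: "scheme_lhs N h D \<Delta>t M u v g i j
      = (\<Sum>q<N * N. ?c q * scheme_lhs N h D \<Delta>t M u v (unit_grid N q) i j)"
    if ij: "1 \<le> i" "i \<le> int N" "1 \<le> j" "j \<le> int N" for i j
  proof -
    have rng: "1 \<le> reflect N a" "reflect N a \<le> int N" if "- 1 \<le> a" "a \<le> int N + 2" for a
      using that assms by (auto simp: reflect_def)
    have ext: "even_ext N g a b = (\<Sum>q<N * N. ?c q * even_ext N (unit_grid N q) a b)"
      if "- 1 \<le> a" "a \<le> int N + 2" "- 1 \<le> b" "b \<le> int N + 2" for a b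
      unfolding even_ext_def using grid_expand rng that by blast
    have "X_op h D M u (even_ext N g) i j
        = (\<Sum>q<N * N. ?c q * X_op h D M u (even_ext N (unit_grid N q)) i j)"
      unfolding X_op_def stencil_sum[OF finite_lessThan, symmetric]
      by (rule stencil_cong, rule ext) (use ij in auto)
    moreover have "Y_op h D M v (even_ext N g) i j
        = (\<Sum>q<N * N. ?c q * Y_op h D M v (even_ext N (unit_grid N q)) i j)"
      unfolding Y_op_def stencil_sum[OF finite_lessThan, symmetric]
      by (rule stencil_cong, rule ext) (use ij in auto)
    moreover have "M i j * (\<Sum>q<N * N. ?c q * unit_grid N q i j) = (\<Sum>q<N * N. ?c q * (M i j * unit_grid N q i j))"
      unfolding sum_distrib_left by (intro sum.cong refl mult.left_commute)
    moreover have "a * (\<Sum>q<N * N. ?c q * F q) = (\<Sum>q<N * N. ?c q * (a * F q))" for a F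
      unfolding sum_distrib_left by (intro sum.cong refl mult.left_commute)
    ultimately show ?thesis
      unfolding scheme_lhs_def by (subst grid_expand[OF ij]) (simp only: distrib_left sum.distrib)
  qed
  have idx_rng: "1 \<le> fst (idx N p)" "fst (idx N p) \<le> int N" "1 \<le> snd (idx N p)" "snd (idx N p) \<le> int N"
    if "p < N * N" for p
  proof -
    have "p div N < N" using that by (rule less_mult_imp_div_less)
    then have d: "int (p div N) < int N" by (rule of_nat_less_iff[THEN iffD2])
    have "p mod N < N" using assms by (intro mod_less_divisor) linarith
    then have m: "int (p mod N) < int N" by (rule of_nat_less_iff[THEN iffD2])
    show "1 \<le> fst (idx N p)" "1 \<le> snd (idx N p)"
      unfolding idx_def by auto
    show "fst (idx N p) \<le> int N" "snd (idx N p) \<le> int N"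
      unfolding idx_def fst_conv snd_conv using zless_imp_add1_zle[OF d] zless_imp_add1_zle[OF m] .
  qed
  have mv: "(coeff_mat N h D \<Delta>t M u v *\<^sub>v grid_vec N g) $ p
      = (case idx N p of (i, j) \<Rightarrow> scheme_lhs N h D \<Delta>t M u v g i j)" if "p < N * N" for p
  proof -
    obtain i j where ij: "idx N p = (i, j)" by fastforce
    have "(coeff_mat N h D \<Delta>t M u v *\<^sub>v grid_vec N g) $ p
       = (\<Sum>q<N * N. scheme_lhs N h D \<Delta>t M u v (unit_grid N q) i j * ?c q)"
      using that ij by (simp add: coeff_mat_def scalar_prod_def grid_vec_def lessThan_atLeast0)
    also have "\<dots> = scheme_lhs N h D \<Delta>t M u v g i j"
      unfolding lin[OF idx_rng[OF that, unfolded ij fst_conv snd_conv]]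
      by (rule sum.cong[OF refl]) (rule mult.commute)
    finally show ?thesis unfolding ij prod.case .
  qed
  show ?thesis (is "?l \<longleftrightarrow> ?r")
  proof
    assume l: ?l
    show ?r
    proof (rule eq_vecI)
      fix p assume "p < dim_vec (grid_vec N (\<lambda>i j. M i j * g0 i j))"
      then have p: "p < N * N" by (simp add: grid_vec_def)
      obtain i j where ij: "idx N p = (i, j)" by fastforce
      have "i \<in> {1..int N}" "j \<in> {1..int N}"
        using idx_rng[OF p] unfolding ij fst_conv snd_conv atLeastAtMost_iff by blast+
      with l have "scheme_lhs N h D \<Delta>t M u v g i j = M i j * g0 i j" by blast
      then show "(coeff_mat N h D \<Delta>t M u v *\<^sub>v grid_vec N g) $ p = grid_vec N (\<lambda>i j. M i j * g0 i j) $ p"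
        unfolding mv[OF p] unfolding grid_vec_def index_vec[OF p] ij prod.case .
    qed (simp add: coeff_mat_def grid_vec_def)
  next
    assume r: ?r
    show ?l
    proof (intro ballI)
      fix i j assume ij: "i \<in> {1..int N}" "j \<in> {1..int N}"
      define p where "p = nat (i - 1) * N + nat (j - 1)"
      have a: "nat (i - 1) < N" "nat (j - 1) < N" using ij by auto
      have "p < (nat (i - 1) + 1) * N" using a by (simp add: p_def)
      also have "\<dots> \<le> N * N" using a by (intro mult_le_mono1) auto
      finally have p: "p < N * N" .
      have ip: "idx N p = (i, j)" using a ij by (simp add: idx_def p_def)
      show "scheme_lhs N h D \<Delta>t M u v g i j = M i j * g0 i j"
        using mv[OF p] unfolding r unfolding grid_vec_def index_vec[OF p] ip prod.case by (rule sym)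
    qed
  qed
qed

end

theory Submission
  imports "HOL-Analysis.Derivative" Defs
begin

text \<open>Written in flux form, both one-dimensional operators are conservative with respect to Simpson's
  quadrature, so the product weights \<open>w\<close> satisfy \<open>w\<^sup>T A = w \<M> > 0\<close> whatever the velocity is.
  Positive off-diagonal entries of \<open>A\<close> only join points at distance two along a grid line, and are
  dominated by the path through the point in between. Let \<open>A\<^sup>z\<close> collect the first steps of these
  paths, scaled by \<open>4/5\<close> if they end at a cell centre. Then \<open>w\<^sup>T (A\<^sub>d + A\<^sup>z) > 0\<close> makes
  \<open>P = A\<^sub>d + A\<^sup>z\<close> an M-matrix, Lorenz's condition (2) makes the off-diagonal entries of
  \<open>Q = P\<^sup>-\<^sup>1 A\<close> nonpositive, and \<open>(w\<^sup>T P) Q = w\<^sup>T A > 0\<close> makes \<open>Q\<close> an M-matrix.\<close>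

section \<open>Lorenz's factorization\<close>

text \<open>Positivity is certified on columns because the row sums of \<open>A\<close> contain the
  discrete divergence of the velocity, while in each column all velocity terms carry the velocity at
  that column's own grid point and cancel or vanish. The two demands on A^z compete: condition (2)
  wants large first steps, positive columns want small ones. Take constant \<M> and zero velocity,
  in units of \<Delta>t D \<M> / h^2. Up to a common factor at the boundary, the steps of a path are
  -2 and -1 and the positive entry is 1/4, so a fraction \<theta> of the first step suffices if the
  diagonal at the middle point is at most 8 \<theta>. So \<theta> must reach about 0.86 at an edge
  midpoint and 0.68 at a cell centre. The columns constrain \<theta> only at cell centres, where
  whole first steps from four sides use up the diffusion part of the diagonal exactly. Conditions
  (b) and (c) keep the entries close enough to these values.\<close>

lemma matrix_mult_index:
  assumes "A \<in> carrier_mat n m" "B \<in> carrier_mat m l" "p < n" "q < l"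
  shows "(A * B) $$ (p, q) = (\<Sum>r<m. A $$ (p, r) * B $$ (r, q))"
  using assms by (auto simp: scalar_prod_def lessThan_atLeast0 intro!: sum.cong)

lemma matrix_vec_index:
  assumes "A \<in> carrier_mat n m" "x \<in> carrier_vec m" "p < n"
  shows "(A *\<^sub>v x) $ p = (\<Sum>r<m. A $$ (p, r) * x $ r)"
  using assms by (auto simp: scalar_prod_def lessThan_atLeast0 intro!: sum.cong)

text \<open>A maximum principle read off the columns: sum the rows in which \<open>y\<close> is
  negative, with weights \<open>w\<close>. The coefficient \<open>C q\<close> so obtained is
  positive on that set, since only nonpositive off-diagonal terms are dropped from a positive column
  sum, and nonpositive elsewhere. Hence no \<open>C q * y q\<close> is positive and the one at
  \<open>p0\<close> is negative, a contradiction.\<close>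

lemma Z_matrix_nonneg_solution:
  fixes Q :: "nat \<Rightarrow> nat \<Rightarrow> real" and w y :: "nat \<Rightarrow> real"
  assumes off: "\<And>p q. p < n \<Longrightarrow> q < n \<Longrightarrow> p \<noteq> q \<Longrightarrow> Q p q \<le> 0"
    and w: "\<And>p. p < n \<Longrightarrow> w p > 0"
    and col: "\<And>q. q < n \<Longrightarrow> (\<Sum>p<n. w p * Q p q) > 0"
    and y: "\<And>p. p < n \<Longrightarrow> (\<Sum>q<n. Q p q * y q) \<ge> 0"
    and p0: "p0 < n"
  shows "y p0 \<ge> 0"
proof (rule ccontr)
  assume neg: "\<not> y p0 \<ge> 0"
  define F where "F = {p\<in>{..<n}. y p < 0}"
  have F: "finite F" "F \<subseteq> {..<n}" "p0 \<in> F" using neg p0 by (auto simp: F_def)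
  define C where "C q = (\<Sum>p\<in>F. w p * Q p q)" for q
  have Cpos: "C q > 0" if "q \<in> F" for q
  proof -
    have q: "q < n" using that F by auto
    have "(\<Sum>p<n. w p * Q p q) = C q + (\<Sum>p\<in>{..<n} - F. w p * Q p q)"
      unfolding C_def by (metis F(2) add.commute finite_lessThan sum.subset_diff)
    moreover have "(\<Sum>p\<in>{..<n} - F. w p * Q p q) \<le> 0"
      using off w q that by (intro sum_nonpos) (auto intro!: mult_nonneg_nonpos simp: less_imp_le)
    ultimately show ?thesis using col[OF q] by linarith
  qed
  have Cneg: "C q \<le> 0" if "q < n" "q \<notin> F" for q
    unfolding C_def using off w F that
    by (intro sum_nonpos mult_nonneg_nonpos) (auto simp: less_imp_le subset_iff)
  have le: "C q * y q \<le> 0" if "q < n" for q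
    using that Cpos[of q] Cneg[of q] by (cases "q \<in> F") (auto simp: F_def mult_le_0_iff)
  have "(\<Sum>p\<in>F. w p * (\<Sum>q<n. Q p q * y q)) = (\<Sum>p\<in>F. \<Sum>q<n. w p * Q p q * y q)"
    by (simp add: sum_distrib_left mult.assoc)
  also have "\<dots> = (\<Sum>q<n. C q * y q)"
    unfolding C_def sum_distrib_right by (rule sum.swap)
  also have "\<dots> < 0"
  proof -
    have "C p0 * y p0 < 0" using Cpos[OF F(3)] neg by (simp add: mult_pos_neg)
    moreover have "(\<Sum>q\<in>{..<n} - {p0}. C q * y q) \<le> 0" using le by (intro sum_nonpos) auto
    ultimately show ?thesis using p0 by (simp add: sum.remove[of _ p0])
  qed
  finally have "(\<Sum>p\<in>F. w p * (\<Sum>q<n. Q p q * y q)) < 0" .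
  moreover have "(\<Sum>p\<in>F. w p * (\<Sum>q<n. Q p q * y q)) \<ge> 0"
  proof (rule sum_nonneg)
    fix p assume "p \<in> F"
    then have "p < n" using F by auto
    then show "0 \<le> w p * (\<Sum>q<n. Q p q * y q)" using y w by (simp add: less_imp_le)
  qed
  ultimately show False by simp
qed

text \<open>In the sum norm with weights \<open>w\<close> the matrix \<open>B\<close> is bounded by
  less than \<open>s\<close> on nonzero vectors. For an eigenvector of maximal modulus, taking
  moduli in the eigenvalue equation and pairing with \<open>w\<close> gives the bound; a nonzero
  component makes it strict.\<close>

lemma spectral_radius_less_weighted:
  assumes B: "B \<in> carrier_mat n n" and n: "n > 0"
    and nonneg: "\<And>p q. p < n \<Longrightarrow> q < n \<Longrightarrow> B $$ (p, q) \<ge> 0"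
    and w: "\<And>p. p < n \<Longrightarrow> w p > 0"
    and col: "\<And>q. q < n \<Longrightarrow> (\<Sum>p<n. w p * B $$ (p, q)) < s * w q"
  shows "spectral_radius (map_mat complex_of_real B) < s"
proof -
  let ?B = "map_mat complex_of_real B"
  have cB: "?B \<in> carrier_mat n n" using B by simp
  obtain l where l: "eigenvalue ?B l" and sl: "spectral_radius ?B = norm l"
    using spectral_radius_mem_max(1)[OF cB n] by (auto simp: spectrum_def)
  from l obtain x where x: "x \<in> carrier_vec n" "x \<noteq> 0\<^sub>v n" "?B *\<^sub>v x = l \<cdot>\<^sub>v x"
    using B by (auto simp: eigenvalue_def eigenvector_def)
  have ineq: "norm l * norm (x $ p) \<le> (\<Sum>q<n. B $$ (p, q) * norm (x $ q))" if "p < n" for p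
  proof -
    have "norm l * norm (x $ p) = norm ((?B *\<^sub>v x) $ p)"
      using x that by (simp add: norm_mult)
    also have "(?B *\<^sub>v x) $ p = (\<Sum>q<n. ?B $$ (p, q) * x $ q)"
      by (rule matrix_vec_index[OF cB x(1) that])
    also have "norm \<dots> \<le> (\<Sum>q<n. norm (?B $$ (p, q) * x $ q))" by (rule norm_sum)
    also have "\<dots> = (\<Sum>q<n. B $$ (p, q) * norm (x $ q))"
      using B nonneg that by (intro sum.cong) (auto simp: norm_mult)
    finally show ?thesis .
  qed
  obtain q0 where q0: "q0 < n" "x $ q0 \<noteq> 0"
    using x by (metis carrier_vecD eq_vecI index_zero_vec(1) index_zero_vec(2))
  have "norm l * (\<Sum>p<n. w p * norm (x $ p)) = (\<Sum>p<n. w p * (norm l * norm (x $ p)))"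
    by (simp add: sum_distrib_left mult_ac)
  also have "\<dots> \<le> (\<Sum>p<n. w p * (\<Sum>q<n. B $$ (p, q) * norm (x $ q)))"
    using ineq w by (intro sum_mono mult_left_mono) (auto simp: less_imp_le)
  also have "\<dots> = (\<Sum>q<n. (\<Sum>p<n. w p * B $$ (p, q)) * norm (x $ q))"
    unfolding sum_distrib_left sum_distrib_right mult.assoc by (rule sum.swap)
  also have "\<dots> < (\<Sum>q<n. s * w q * norm (x $ q))"
    using col q0 by (intro sum_strict_mono_ex1)
      (auto intro!: mult_right_mono bexI[of _ q0] mult_strict_right_mono simp: less_imp_le)
  also have "\<dots> = s * (\<Sum>p<n. w p * norm (x $ p))" by (simp add: sum_distrib_left mult_ac)
  finally have "norm l * (\<Sum>p<n. w p * norm (x $ p)) < s * (\<Sum>p<n. w p * norm (x $ p))" .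
  moreover have "(\<Sum>p<n. w p * norm (x $ p)) \<ge> 0"
    using w by (intro sum_nonneg) (auto simp: less_imp_le)
  ultimately show ?thesis unfolding sl by (simp add: mult_less_cancel_right)
qed

lemma nonneg_mat_iff:
  "A \<in> carrier_mat n n \<Longrightarrow> nonneg_mat A \<longleftrightarrow> (\<forall>p<n. \<forall>q<n. 0 \<le> A $$ (p, q))"
  by (auto simp: nonneg_mat_def less_eq_mat_def)

lemma nonpos_mat_iff:
  "A \<in> carrier_mat n n \<Longrightarrow> nonpos_mat A \<longleftrightarrow> (\<forall>p<n. \<forall>q<n. A $$ (p, q) \<le> 0)"
  by (auto simp: nonpos_mat_def less_eq_mat_def)

text \<open>With \<open>s\<close> the largest diagonal entry, \<open>B\<close> is nonnegative, and
  its weighted column sums are \<open>s * w q\<close> minus those of \<open>Q\<close>, hence below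
  \<open>s * w q\<close>.\<close>

lemma Z_matrix_M_matrix:
  assumes Q: "Q \<in> carrier_mat n n" and n: "n > 0"
    and off: "\<And>p q. p < n \<Longrightarrow> q < n \<Longrightarrow> p \<noteq> q \<Longrightarrow> Q $$ (p, q) \<le> 0"
    and w: "\<And>p. p < n \<Longrightarrow> w p > 0"
    and col: "\<And>q. q < n \<Longrightarrow> (\<Sum>p<n. w p * Q $$ (p, q)) > 0"
  shows "M_matrix Q"
proof -
  define s where "s = Max ((\<lambda>p. Q $$ (p, p)) ` {..<n})"
  define B where "B = s \<cdot>\<^sub>m 1\<^sub>m n - Q"
  have B: "B \<in> carrier_mat n n" using Q by (simp add: B_def minus_carrier_mat)
  have Bi: "B $$ (p, q) = (if p = q then s else 0) - Q $$ (p, q)" if "p < n" "q < n" for p q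
    using that Q by (simp add: B_def)
  have smax: "Q $$ (p, p) \<le> s" if "p < n" for p
    unfolding s_def using that by (intro Max_ge) auto
  have nn: "B $$ (p, q) \<ge> 0" if "p < n" "q < n" for p q
    using Bi[OF that] smax off that by auto
  have "(\<Sum>p<n. w p * B $$ (p, q)) < s * w q" if q: "q < n" for q
  proof -
    have "(\<Sum>p<n. w p * B $$ (p, q)) = (\<Sum>p<n. (if p = q then s * w p else 0) - w p * Q $$ (p, q))"
      using q by (intro sum.cong) (auto simp: Bi right_diff_distrib)
    also have "\<dots> = s * w q - (\<Sum>p<n. w p * Q $$ (p, q))"
      using q by (simp add: sum_subtractf)
    finally show ?thesis using col[OF q] by simp
  qed
  then have "spectral_radius (map_mat complex_of_real B) < s"
    using spectral_radius_less_weighted[of B n w s] B n nn w by blast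
  moreover have "Q = s \<cdot>\<^sub>m 1\<^sub>m n - B"
    using Q B by (intro eq_matI) (auto simp: Bi)
  ultimately show ?thesis
    unfolding M_matrix_def using Q B nn by (auto simp: nonneg_mat_iff intro!: exI[of _ s] exI[of _ B])
qed

text \<open>Positivity of solutions applied to \<open>v\<close> and to its negative gives
  injectivity; applied to the columns of the inverse, which \<open>Q\<close> maps to unit vectors,
  it gives their sign.\<close>

lemma Z_matrix_inverse:
  fixes Q :: "real mat"
  assumes Q: "Q \<in> carrier_mat n n"
    and off: "\<And>p q. p < n \<Longrightarrow> q < n \<Longrightarrow> p \<noteq> q \<Longrightarrow> Q $$ (p, q) \<le> 0"
    and w: "\<And>p. p < n \<Longrightarrow> w p > 0"
    and col: "\<And>q. q < n \<Longrightarrow> (\<Sum>p<n. w p * Q $$ (p, q)) > 0"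
  obtains B where "B \<in> carrier_mat n n" "Q * B = 1\<^sub>m n" "B * Q = 1\<^sub>m n"
    "\<And>p q. p < n \<Longrightarrow> q < n \<Longrightarrow> B $$ (p, q) \<ge> 0"
proof -
  have pos: "y p \<ge> 0" if "\<And>p. p < n \<Longrightarrow> (\<Sum>q<n. Q $$ (p, q) * y q) \<ge> 0" "p < n" for y p
    by (rule Z_matrix_nonneg_solution[where Q = "\<lambda>p q. Q $$ (p, q)", OF off w col that])
  have "det Q \<noteq> 0"
  proof
    assume "det Q = 0"
    then obtain v where v: "v \<in> carrier_vec n" "v \<noteq> 0\<^sub>v n" "Q *\<^sub>v v = 0\<^sub>v n"
      using det_0_iff_vec_prod_zero_field[OF Q] by auto
    have z: "(\<Sum>q<n. Q $$ (p, q) * v $ q) = 0" if "p < n" for p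
      using matrix_vec_index[OF Q v(1) that] v(3) that by simp
    have "v $ p = 0" if "p < n" for p
    proof (rule antisym)
      have "(\<Sum>q<n. Q $$ (p, q) * - v $ q) = 0" if "p < n" for p
        using z[OF that] by (simp add: sum_negf)
      then show "v $ p \<le> 0" using pos[of "\<lambda>p. - v $ p" p] that by simp
      show "0 \<le> v $ p" using pos[of "\<lambda>p. v $ p" p] z that by simp
    qed
    then have "v = 0\<^sub>v n" using v(1) by (intro eq_vecI) auto
    with v(2) show False by simp
  qed
  from det_non_zero_imp_unit[OF Q this, of n] obtain B where
    B: "B \<in> carrier_mat n n" "B * Q = 1\<^sub>m n" "Q * B = 1\<^sub>m n"
    unfolding Units_def ring_mat_def by auto
  have "B $$ (p, q) \<ge> 0" if pq: "p < n" "q < n" for p q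
  proof (rule pos[of "\<lambda>p. B $$ (p, q)"])
    fix r assume r: "r < n"
    have "(\<Sum>s<n. Q $$ (r, s) * B $$ (s, q)) = (1\<^sub>m n :: real mat) $$ (r, q)"
      using matrix_mult_index[OF Q B(1) r pq(2)] B(3) by simp
    then show "(\<Sum>s<n. Q $$ (r, s) * B $$ (s, q)) \<ge> 0" using r pq by simp
  qed (fact pq)
  with that B show ?thesis by blast
qed

text \<open>Lorenz's factorization with the positivity of \<open>A\<close> certified on the columns: a positive weight
  \<open>w\<close> with \<open>w\<^sup>T A > 0\<close> and \<open>w\<^sup>T (A\<^sub>d + A\<^sup>z) > 0\<close> replaces the vector \<open>e\<close> of condition (3), which
  can be recovered afterwards as \<open>A\<^sup>-\<^sup>1 1\<close>.\<close>

lemma lorenz_column_weights: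
  fixes A Az As :: "real mat"
  assumes A: "A \<in> carrier_mat n n" and n: "n > 0"
    and Az: "Az \<in> carrier_mat n n"
    and As: "As = neg_offdiag A - Az"
    and diag: "\<And>p. p < n \<Longrightarrow> A $$ (p, p) > 0"
    and Az_nonpos: "\<And>p q. p < n \<Longrightarrow> q < n \<Longrightarrow> Az $$ (p, q) \<le> 0"
    and As_nonpos: "\<And>p q. p < n \<Longrightarrow> q < n \<Longrightarrow> As $$ (p, q) \<le> 0"
    and pos: "\<And>p q. p < n \<Longrightarrow> q < n \<Longrightarrow> p \<noteq> q \<Longrightarrow> A $$ (p, q) > 0 \<Longrightarrow>
      A $$ (p, q) \<le> (\<Sum>r<n. Az $$ (p, r) * As $$ (r, q) / A $$ (r, r))"
    and w: "\<And>p. p < n \<Longrightarrow> w p > 0"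
    and colA: "\<And>q. q < n \<Longrightarrow> (\<Sum>p<n. w p * A $$ (p, q)) > 0"
    and colz: "\<And>q. q < n \<Longrightarrow> w q * A $$ (q, q) + (\<Sum>p<n. w p * Az $$ (p, q)) > 0"
  shows "lorenz_conditions A"
    and "\<exists>P Q. P \<in> carrier_mat n n \<and> Q \<in> carrier_mat n n \<and> M_matrix P \<and> M_matrix Q \<and> A = P * Q"
    and "monotone_mat A"
proof -
  define Ad where "Ad = diag_part A"
  define Ap where "Ap = pos_offdiag A"
  define Di where "Di = mat n n (\<lambda>(p, q). if p = q then 1 / A $$ (p, p) else 0)"
  define P where "P = Ad + Az"
  have Ad: "Ad \<in> carrier_mat n n" and Ap: "Ap \<in> carrier_mat n n" and Di: "Di \<in> carrier_mat n n"
    using A by (auto simp: Ad_def Ap_def Di_def diag_part_def pos_offdiag_def)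
  have An: "neg_offdiag A \<in> carrier_mat n n"
    using A Ad Ap by (auto simp: neg_offdiag_def Ad_def Ap_def)
  have Asc: "As \<in> carrier_mat n n" using An Az by (auto simp: As)
  have P: "P \<in> carrier_mat n n" using Ad Az by (simp add: P_def)
  have Ad_i: "Ad $$ (p, q) = (if p = q then A $$ (p, p) else 0)" if "p < n" "q < n" for p q
    using that A by (simp add: Ad_def diag_part_def)
  have Ap_i: "Ap $$ (p, q) = (if p \<noteq> q \<and> A $$ (p, q) > 0 then A $$ (p, q) else 0)"
    if "p < n" "q < n" for p q
    using that A by (simp add: Ap_def pos_offdiag_def)
  have A_split: "A $$ (p, q) = Ad $$ (p, q) + Az $$ (p, q) + As $$ (p, q) + Ap $$ (p, q)"
    if "p < n" "q < n" for p q
    using that A Ad Ap Az An by (simp add: As neg_offdiag_def Ad_def Ap_def)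
  have DiAs: "(Di * As) $$ (r, q) = As $$ (r, q) / A $$ (r, r)" if rq: "r < n" "q < n" for r q
  proof -
    have "(Di * As) $$ (r, q) = (\<Sum>s<n. Di $$ (r, s) * As $$ (s, q))"
      by (rule matrix_mult_index[OF Di Asc rq])
    also have "\<dots> = (\<Sum>s<n. if s = r then As $$ (r, q) / A $$ (r, r) else 0)"
      using rq by (intro sum.cong) (auto simp: Di_def)
    finally show ?thesis using rq by simp
  qed
  define R where "R = Az * Di * As"
  have R: "R \<in> carrier_mat n n" using Az Di Asc by (simp add: R_def)
  have R_i: "R $$ (p, q) = (\<Sum>r<n. Az $$ (p, r) * As $$ (r, q) / A $$ (r, r))" if pq: "p < n" "q < n" for p q
  proof -
    have "R = Az * (Di * As)" unfolding R_def by (rule assoc_mult_mat[OF Az Di Asc])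
    then have "R $$ (p, q) = (\<Sum>r<n. Az $$ (p, r) * (Di * As) $$ (r, q))"
      using matrix_mult_index[OF Az mult_carrier_mat[OF Di Asc] pq] by simp
    then show ?thesis using DiAs pq by simp
  qed
  have R_nonneg: "R $$ (p, q) \<ge> 0" if "p < n" "q < n" for p q
    unfolding R_i[OF that] using Az_nonpos As_nonpos diag that
    by (intro sum_nonneg divide_nonneg_pos mult_nonpos_nonpos) auto
  have ApR: "Ap $$ (p, q) \<le> R $$ (p, q)" if "p < n" "q < n" for p q
    using Ap_i[OF that] R_nonneg[OF that] R_i[OF that] pos[OF that] by auto
  have P_i: "P $$ (p, q) = Ad $$ (p, q) + Az $$ (p, q)" if "p < n" "q < n" for p q
    using that Ad Az by (simp add: P_def)
  have P_off: "P $$ (p, q) \<le> 0" if "p < n" "q < n" "p \<noteq> q" for p q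
    using that P_i Ad_i Az_nonpos by simp
  define w' where "w' q = (\<Sum>p<n. w p * P $$ (p, q))" for q
  have w': "w' q > 0" if q: "q < n" for q
  proof -
    have "w' q = (\<Sum>p<n. (if p = q then w q * A $$ (q, q) else 0) + w p * Az $$ (p, q))"
      unfolding w'_def using q P_i Ad_i by (intro sum.cong) (auto simp: algebra_simps)
    also have "\<dots> = w q * A $$ (q, q) + (\<Sum>p<n. w p * Az $$ (p, q))"
      using q by (simp add: sum.distrib)
    finally show ?thesis using colz[OF q] by simp
  qed
  have MP: "M_matrix P"
    by (rule Z_matrix_M_matrix[OF P n P_off w w'[unfolded w'_def]])
  obtain Pi where Pi: "Pi \<in> carrier_mat n n" "P * Pi = 1\<^sub>m n" "Pi * P = 1\<^sub>m n"
    and Pi_nn: "\<And>p q. p < n \<Longrightarrow> q < n \<Longrightarrow> Pi $$ (p, q) \<ge> 0"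
    using Z_matrix_inverse[OF P P_off w w'[unfolded w'_def]] by blast
  define Q where "Q = Pi * A"
  have Q: "Q \<in> carrier_mat n n" using Pi A by (simp add: Q_def)
  have PQ: "A = P * Q"
    unfolding Q_def using assoc_mult_mat[OF P Pi(1) A] Pi(2) A by simp
  \<comment> \<open>\<open>S\<close> is the slack in condition (2). Expanding \<open>P * T\<close>
    gives \<open>A\<close> with its positive part replaced by \<open>R\<close>, that is
    \<open>A + S\<close>. Multiplication by the nonnegative \<open>Pi\<close> yields
    \<open>Q = T - Pi * S\<close>; off the diagonal \<open>T\<close> is \<open>As\<close> divided by
    a positive diagonal entry, so both contributions are nonpositive.\<close>
  define S where "S = R - Ap"
  have S: "S \<in> carrier_mat n n" using R Ap by (simp add: S_def minus_carrier_mat)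
  define T where "T = 1\<^sub>m n + Di * As"
  have T: "T \<in> carrier_mat n n" using Di Asc by (simp add: T_def)
  have AdDi: "Ad * Di = 1\<^sub>m n"
  proof (rule eq_matI)
    fix p q assume "p < dim_row (1\<^sub>m n :: real mat)" "q < dim_col (1\<^sub>m n :: real mat)"
    then have pq: "p < n" "q < n" by auto
    have "(Ad * Di) $$ (p, q) = (\<Sum>s<n. Ad $$ (p, s) * Di $$ (s, q))"
      by (rule matrix_mult_index[OF Ad Di pq])
    also have "\<dots> = (\<Sum>s<n. if s = p then (if p = q then 1 else 0) else 0)"
      using pq diag[of p] Ad_i by (intro sum.cong) (auto simp: Di_def)
    finally show "(Ad * Di) $$ (p, q) = (1\<^sub>m n :: real mat) $$ (p, q)" using pq by simp
  qed (use Ad Di in auto)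
  have AdT: "Ad * (Di * As) = As"
    using assoc_mult_mat[OF Ad Di Asc] AdDi Asc by simp
  have PT: "P * T = A + S"
  proof -
    have c: "Di * As \<in> carrier_mat n n" using Di Asc by simp
    have "P * T = P * 1\<^sub>m n + P * (Di * As)"
      unfolding T_def by (rule mult_add_distrib_mat[OF P _ c]) simp
    also have "P * (Di * As) = Ad * (Di * As) + Az * (Di * As)"
      unfolding P_def by (rule add_mult_distrib_mat[OF Ad Az c])
    also have "Az * (Di * As) = R" unfolding R_def using assoc_mult_mat[OF Az Di Asc] by simp
    finally have "P * T = P + (As + R)" using AdT P by simp
    also have "\<dots> = A + S"
      using P Asc R A S Ap by (intro eq_matI) (auto simp: A_split S_def P_i)
    finally show ?thesis .
  qed
  have QT: "Q = T - Pi * S"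
  proof -
    have "T = Pi * (P * T)" using assoc_mult_mat[OF Pi(1) P T] Pi(3) T by simp
    also have "\<dots> = Q + Pi * S"
      unfolding PT Q_def by (rule mult_add_distrib_mat[OF Pi(1) A S])
    finally show ?thesis using Q Pi S by (intro eq_matI) auto
  qed
  have S_nn: "S $$ (p, q) \<ge> 0" if "p < n" "q < n" for p q
    using ApR[OF that] that Ap R by (simp add: S_def)
  have Q_off: "Q $$ (p, q) \<le> 0" if pq: "p < n" "q < n" "p \<noteq> q" for p q
  proof -
    have "(Pi * S) $$ (p, q) = (\<Sum>r<n. Pi $$ (p, r) * S $$ (r, q))"
      by (rule matrix_mult_index[OF Pi(1) S pq(1,2)])
    also have "\<dots> \<ge> 0" using Pi_nn S_nn pq by (intro sum_nonneg mult_nonneg_nonneg) auto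
    finally have "(Pi * S) $$ (p, q) \<ge> 0" .
    moreover have "T $$ (p, q) = As $$ (p, q) / A $$ (p, p)"
      using pq DiAs[of p q] Di Asc by (simp add: T_def del: index_mult_mat(1))
    moreover have "As $$ (p, q) / A $$ (p, p) \<le> 0"
      using As_nonpos diag pq by (intro divide_nonpos_pos) auto
    moreover have "Q $$ (p, q) = T $$ (p, q) - (Pi * S) $$ (p, q)"
      unfolding QT using pq T Pi S by (simp del: index_mult_mat(1))
    ultimately show ?thesis by linarith
  qed
  have colQ: "(\<Sum>p<n. w' p * Q $$ (p, q)) > 0" if q: "q < n" for q
  proof -
    have "(\<Sum>p<n. w p * A $$ (p, q)) = (\<Sum>p<n. w p * (\<Sum>r<n. P $$ (p, r) * Q $$ (r, q)))"
      unfolding PQ using matrix_mult_index[OF P Q _ q] by simp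
    also have "\<dots> = (\<Sum>r<n. w' r * Q $$ (r, q))"
      unfolding w'_def sum_distrib_left sum_distrib_right mult.assoc by (rule sum.swap)
    finally show ?thesis using colA[OF q] by simp
  qed
  have MQ: "M_matrix Q" by (rule Z_matrix_M_matrix[OF Q n Q_off w' colQ])
  obtain Qi where Qi: "Qi \<in> carrier_mat n n" "Q * Qi = 1\<^sub>m n" "Qi * Q = 1\<^sub>m n"
    and Qi_nn: "\<And>p q. p < n \<Longrightarrow> q < n \<Longrightarrow> Qi $$ (p, q) \<ge> 0"
    using Z_matrix_inverse[OF Q Q_off w' colQ] by blast
  show "\<exists>P Q. P \<in> carrier_mat n n \<and> Q \<in> carrier_mat n n \<and> M_matrix P \<and> M_matrix Q \<and> A = P * Q"
    using P Q MP MQ PQ by blast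
  define B where "B = Qi * Pi"
  have B: "B \<in> carrier_mat n n" using Qi Pi by (simp add: B_def)
  have AB: "A * B = 1\<^sub>m n"
  proof -
    have "A * B = P * (Q * (Qi * Pi))"
      unfolding B_def PQ by (rule assoc_mult_mat[OF P Q mult_carrier_mat[OF Qi(1) Pi(1)]])
    also have "Q * (Qi * Pi) = Pi" using assoc_mult_mat[OF Q Qi(1) Pi(1)] Qi(2) Pi(1) by simp
    finally show ?thesis using Pi(2) by simp
  qed
  have BA: "B * A = 1\<^sub>m n" by (rule mat_mult_left_right_inverse[OF A B AB])
  have B_nn: "B $$ (p, q) \<ge> 0" if pq: "p < n" "q < n" for p q
    unfolding B_def matrix_mult_index[OF Qi(1) Pi(1) pq]
    using Qi_nn Pi_nn pq by (intro sum_nonneg mult_nonneg_nonneg) auto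
  show "monotone_mat A"
    unfolding monotone_mat_def is_inverse_mat_def inverts_mat_def
    using A B AB BA B_nn by (intro exI[of _ B]) (auto simp: nonneg_mat_iff)
  define o1 :: "real vec" where "o1 = vec n (\<lambda>_. 1)"
  define e where "e = B *\<^sub>v o1"
  have o1: "o1 \<in> carrier_vec n" by (simp add: o1_def)
  have e: "e \<in> carrier_vec n" using B o1 by (simp add: e_def)
  have Ae: "A *\<^sub>v e = o1"
    unfolding e_def using assoc_mult_mat_vec[OF A B o1] AB o1 by simp
  have e_nn: "0\<^sub>v n \<le> e"
    unfolding less_eq_vec_def
  proof (intro conjI allI impI)
    fix p assume "p < dim_vec e"
    then have p: "p < n" using e by simp
    show "0\<^sub>v n $ p \<le> e $ p"
      using p B_nn unfolding e_def matrix_vec_index[OF B o1 p]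
      by (auto simp: o1_def intro!: sum_nonneg)
  qed (use e in simp)
  have e_nz: "e \<noteq> 0\<^sub>v n"
  proof
    assume "e = 0\<^sub>v n"
    then have "(A *\<^sub>v e) $ 0 = 0" using A n matrix_vec_index[OF A, of e 0] by simp
    then show False using n by (simp add: Ae o1_def)
  qed
  have dim: "dim_row A = n" using A by simp
  have DiInv: "is_inverse_mat Ad Di"
    using Ad Di AdDi mat_mult_left_right_inverse[OF Ad Di]
    by (simp add: is_inverse_mat_def inverts_mat_def)
  have neg: "neg_offdiag A = Az + As"
    using An Az by (intro eq_matI) (auto simp: As)
  \<comment> \<open>All components of \<open>A e\<close> are 1, so there is no index from which a
    connecting path would have to start.\<close>
  have "{p. p < n \<and> (A *\<^sub>v e) $ p = 0} = {}" by (auto simp: Ae o1_def)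
  then have con: "connects Az {p. p < n \<and> (A *\<^sub>v e) $ p = 0} X" for X
    by (simp only: connects_def Set.ball_empty)
  have o1_nn: "0\<^sub>v n \<le> A *\<^sub>v e" unfolding Ae by (auto simp: o1_def less_eq_vec_def)
  have ApR': "Ap \<le> R" using ApR Ap R by (auto simp: less_eq_mat_def)
  show "lorenz_conditions A"
    unfolding lorenz_conditions_def dim Let_def
    using A Az Asc neg MP DiInv ApR' e e_nz e_nn o1_nn con Az_nonpos As_nonpos
    by (intro conjI exI[of _ Az, OF exI[of _ As]] exI[of _ Di] bexI[of _ e] disjI1)
      (auto simp: nonpos_mat_iff P_def Ad_def Ap_def R_def)
qed

section \<open>One grid line\<close>

definition diag_tap :: "real \<Rightarrow> real \<Rightarrow> (int \<Rightarrow> real) \<Rightarrow> int \<Rightarrow> real" where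
  "diag_tap h D m i =
     (if odd i then D / (8 * h^2) * (m (i-2) + 4 * m (i-1) + 18 * m i + 4 * m (i+1) + m (i+2))
      else D / h^2 * (m (i-1) + m (i+1)))"

text \<open>The sign \<open>s\<close>, 1 or -1, names the side, so that reflection at an end and
  both directions of a path are served by one formula.\<close>

definition near_tap :: "real \<Rightarrow> real \<Rightarrow> (int \<Rightarrow> real) \<Rightarrow> (int \<Rightarrow> real) \<Rightarrow> int \<Rightarrow> int \<Rightarrow> real" where
  "near_tap h D m w i s =
     (if odd i then - of_int s * w (i+s) / h - D / (8 * h^2) * (12 * m i + 4 * m (i + 2 * s))
      else - of_int s * w (i+s) / (2 * h) - D / (4 * h^2) * (m (i-s) + 3 * m (i+s)))"

definition far_tap :: "real \<Rightarrow> real \<Rightarrow> (int \<Rightarrow> real) \<Rightarrow> (int \<Rightarrow> real) \<Rightarrow> int \<Rightarrow> int \<Rightarrow> real" where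
  "far_tap h D m w i s =
     of_int s * w (i + 2 * s) / (4 * h) + D / (8 * h^2) * (3 * m i - 4 * m (i+s) + 3 * m (i + 2 * s))"

lemma stencil_taps_odd:
  assumes "odd i" "h > 0"
  shows "stencil h D m w g i = diag_tap h D m i * g i
    + near_tap h D m w i 1 * g (i+1) + near_tap h D m w i (-1) * g (i-1)
    + far_tap h D m w i 1 * g (i+2) + far_tap h D m w i (-1) * g (i-2)"
proof -
  define c where "c = D / (8 * h^2)"
  have "w b / h = 4 * (w b / (4 * h))" for b by simp
  then show ?thesis
    using assms(1)
    unfolding stencil_def conv_odd_def diag_tap_def near_tap_def far_tap_def c_def[symmetric]
    by (simp add: add_divide_distrib diff_divide_distrib) (simp add: algebra_simps)
qed

lemma stencil_taps_even:
  assumes "even i" "h > 0"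
  shows "stencil h D m w g i = diag_tap h D m i * g i
    + near_tap h D m w i 1 * g (i+1) + near_tap h D m w i (-1) * g (i-1)"
proof -
  define c where "c = D / (4 * h^2)"
  have "D / h^2 = 4 * c" by (simp add: c_def)
  then show ?thesis
    using assms(1)
    unfolding stencil_def conv_even_def diag_tap_def near_tap_def c_def[symmetric]
    by (simp add: add_divide_distrib diff_divide_distrib) (simp add: algebra_simps)
qed

text \<open>The indicator of column \<open>a\<close> is composed with \<open>reflect\<close>, so
  coefficients at ghost points are added to those of their mirror images.\<close>

definition line_entry ::
  "nat \<Rightarrow> real \<Rightarrow> real \<Rightarrow> (int \<Rightarrow> real) \<Rightarrow> (int \<Rightarrow> real) \<Rightarrow> int \<Rightarrow> int \<Rightarrow> real" where
  "line_entry N h D m w i a = stencil h D m w (\<lambda>b. if reflect N b = a then 1 else 0) i"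

text \<open>Positive off-diagonal entries occur only in odd rows, at distance two, so a path can
  only open with a step from an odd index to an even neighbour.\<close>

definition line_z ::
  "nat \<Rightarrow> real \<Rightarrow> real \<Rightarrow> (int \<Rightarrow> real) \<Rightarrow> (int \<Rightarrow> real) \<Rightarrow> int \<Rightarrow> int \<Rightarrow> real" where
  "line_z N h D m w i a = (if odd i \<and> \<bar>a - i\<bar> = 1 then line_entry N h D m w i a else 0)"

text \<open>In an end row the two taps of equal distance fall on the same column; this is the
  resulting factor.\<close>

definition edge_mult :: "nat \<Rightarrow> int \<Rightarrow> real" where
  "edge_mult N i = (if i = 1 \<or> i = int N then 2 else 1)"

text \<open>Simpson's weights \<open>h/3, 4h/3, 2h/3, \<dots>, 4h/3, h/3\<close>, scaled by \<open>3/(2h)\<close>; the one-dimensional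
  operator is conservative with respect to this quadrature rule.\<close>

definition simpson :: "nat \<Rightarrow> int \<Rightarrow> real" where
  "simpson N i = (if even i then 2 else 1) / edge_mult N i"

lemma edge_mult_pos: "edge_mult N i > 0"
  by (simp add: edge_mult_def)

lemma simpson_pos: "simpson N i > 0"
  by (simp add: simpson_def edge_mult_def)

text \<open>A rational upper bound for \<open>sqrt 2 / 320\<close>.\<close>

definition grad_tol :: real where "grad_tol = 9 / 2000"

text \<open>The data seen along one line in either direction. Conditions (b) and (c) enter
  pointwise, relative to \<open>m i\<close>. \<open>m_near\<close> also covers ghost neighbours,
  which the diagonal tap of an end row involves; \<open>w_small\<close> is confined to grid
  indices.\<close>

locale scheme_line =
  fixes N :: nat and h D :: real and m w :: "int \<Rightarrow> real"
  assumes N: "odd N" "N \<ge> 3" and h: "h > 0" and D: "D > 0"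
    and m_ghost: "m 0 = m 2" "m (-1) = m 3" "m (int N + 1) = m (int N - 1)" "m (int N + 2) = m (int N - 2)"
    and w_ghost: "w 0 = - w 2" "w (-1) = - w 3" "w (int N + 1) = - w (int N - 1)" "w (int N + 2) = - w (int N - 2)"
    and w_edge: "w 1 = 0" "w (int N) = 0"
    and m_pos: "\<And>i. 1 \<le> i \<Longrightarrow> i \<le> int N \<Longrightarrow> m i > 0"
    and m_near: "\<And>i s. 1 \<le> i \<Longrightarrow> i \<le> int N \<Longrightarrow> \<bar>s\<bar> \<le> 2 \<Longrightarrow>
      \<bar>m (i + s) - m i\<bar> \<le> \<bar>of_int s\<bar> * grad_tol * m i"
    and w_small: "\<And>i a. 1 \<le> i \<Longrightarrow> i \<le> int N \<Longrightarrow> 1 \<le> a \<Longrightarrow> a \<le> int N \<Longrightarrow> \<bar>a - i\<bar> \<le> 1 \<Longrightarrow>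
      h * \<bar>w a\<bar> \<le> D / 20 * m i"
begin

abbreviation "dg \<equiv> diag_tap h D m"
abbreviation "nr \<equiv> near_tap h D m w"
abbreviation "fr \<equiv> far_tap h D m w"
abbreviation "E \<equiv> line_entry N h D m w"
abbreviation "Z \<equiv> line_z N h D m w"
abbreviation "mu \<equiv> simpson N"

text \<open>Even reflection of \<open>m\<close> and odd reflection of \<open>w\<close> compensate
  the change of sign of \<open>s\<close>, so taps folded onto one column are equal.\<close>

lemma edge_taps:
  "nr 1 (-1) = nr 1 1" "fr 1 (-1) = fr 1 1"
  "nr (int N) 1 = nr (int N) (-1)" "fr (int N) 1 = fr (int N) (-1)"
  using N m_ghost w_ghost by (simp_all add: near_tap_def far_tap_def)

section \<open>Entries of the line matrix after folding in the ghost points\<close>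

lemma entry_even:
  assumes "even i" "1 \<le> i" "i \<le> int N"
  shows "E i a = (if a = i then dg i else 0) + (if a = i + 1 then nr i 1 else 0)
    + (if a = i - 1 then nr i (-1) else 0)"
proof -
  have "i \<noteq> 1" "i \<noteq> int N" using assms N by auto
  then have "2 \<le> i" "i \<le> int N - 1" using assms by auto
  then show ?thesis
    unfolding line_entry_def stencil_taps_even[OF assms(1) h] by (auto simp: reflect_def)
qed

lemma entry_odd:
  assumes "odd i" "1 < i" "i < int N"
  shows "E i a = (if a = i then dg i else 0) + (if a = i + 1 then nr i 1 else 0)
    + (if a = i - 1 then nr i (-1) else 0) + (if a = i + 2 then fr i 1 else 0)
    + (if a = i - 2 then fr i (-1) else 0)"
proof -
  have "i \<noteq> 2" "i \<noteq> int N - 1" using assms N by auto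
  then have "3 \<le> i" "i \<le> int N - 2" using assms by auto
  then show ?thesis
    unfolding line_entry_def stencil_taps_odd[OF assms(1) h] by (auto simp: reflect_def)
qed

lemma entry_first:
  "E 1 a = (if a = 1 then dg 1 else 0) + (if a = 2 then 2 * nr 1 1 else 0)
    + (if a = 3 then 2 * fr 1 1 else 0)"
proof -
  have "3 \<le> int N" using N by simp
  then show ?thesis
    unfolding line_entry_def stencil_taps_odd[OF odd_one h] by (auto simp: reflect_def edge_taps)
qed

lemma entry_last:
  "E (int N) a = (if a = int N then dg (int N) else 0)
    + (if a = int N - 1 then 2 * nr (int N) (-1) else 0)
    + (if a = int N - 2 then 2 * fr (int N) (-1) else 0)"
proof -
  have o: "odd (int N)" and "3 \<le> int N" using N by auto
  then show ?thesis
    unfolding line_entry_def stencil_taps_odd[OF o h] by (auto simp: reflect_def edge_taps)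
qed

lemma grid_cases:
  assumes "1 \<le> i" "i \<le> int N"
  obtains "even i" "1 < i" "i < int N" | "i = 1" | "i = int N" | "odd i" "1 < i" "i < int N"
  using assms N by fastforce

lemma entry_diag:
  assumes "1 \<le> i" "i \<le> int N" shows "E i i = dg i"
  using assms
proof (cases rule: grid_cases)
  case 1 then show ?thesis by (simp add: entry_even)
next
  case 2 then show ?thesis by (simp add: entry_first)
next
  case 3 then show ?thesis by (simp add: entry_last)
next
  case 4 then show ?thesis by (simp add: entry_odd)
qed

lemma entry_near:
  assumes "1 \<le> i" "i \<le> int N" "1 \<le> i + s" "i + s \<le> int N" "\<bar>s\<bar> = 1"
  shows "E i (i + s) = edge_mult N i * nr i s"
proof -
  have s: "s = 1 \<or> s = -1" using assms(5) by linarith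
  from assms(1,2) show ?thesis
  proof (cases rule: grid_cases)
    case 1 then show ?thesis using s by (auto simp: entry_even edge_mult_def)
  next
    case 2 then show ?thesis using s assms by (auto simp: entry_first edge_mult_def)
  next
    case 3 then show ?thesis using s assms by (auto simp: entry_last edge_mult_def)
  next
    case 4 then show ?thesis using s by (auto simp: entry_odd edge_mult_def)
  qed
qed

lemma entry_far:
  assumes "odd i" "1 \<le> i" "i \<le> int N" "1 \<le> i + 2 * s" "i + 2 * s \<le> int N" "\<bar>s\<bar> = 1"
  shows "E i (i + 2 * s) = edge_mult N i * fr i s"
proof -
  have s: "s = 1 \<or> s = -1" using assms(6) by linarith
  from assms(2,3) show ?thesis
  proof (cases rule: grid_cases)
    case 1 then show ?thesis using assms by auto
  next
    case 2 then show ?thesis using s assms by (auto simp: entry_first edge_mult_def)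
  next
    case 3 then show ?thesis using s assms by (auto simp: entry_last edge_mult_def)
  next
    case 4 then show ?thesis using s by (auto simp: entry_odd edge_mult_def)
  qed
qed

lemma entry_zero:
  assumes "1 \<le> i" "i \<le> int N" "a \<noteq> i" "\<bar>a - i\<bar> \<noteq> 1" "\<not> (odd i \<and> \<bar>a - i\<bar> = 2)"
  shows "E i a = 0"
  using assms(1,2)
proof (cases rule: grid_cases)
  case 1 then show ?thesis using assms by (auto simp: entry_even)
next
  case 2 then show ?thesis using assms by (auto simp: entry_first)
next
  case 3 then show ?thesis using assms N by (auto simp: entry_last)
next
  case 4 then show ?thesis using assms by (auto simp: entry_odd)
qed

section \<open>Conservation with respect to Simpson's weights\<close>

lemma simpson_even: "even i \<Longrightarrow> mu i = 2"
  using N by (auto simp: simpson_def edge_mult_def)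

lemma simpson_odd_mult: "odd i \<Longrightarrow> mu i * (edge_mult N i * x) = x"
  using edge_mult_pos[of N i] by (simp add: simpson_def)

lemma edge_mult_even: "even i \<Longrightarrow> edge_mult N i = 1"
  using N by (auto simp: edge_mult_def)

text \<open>Every velocity term in column \<open>a\<close> contains \<open>w a\<close>: these terms
  cancel in the interior, and at the ends \<open>w a\<close> vanishes. The terms in \<open>m\<close>
  cancel as a linear identity, at the ends after inserting the ghost values.\<close>

lemma column_sum:
  assumes a: "1 \<le> a" "a \<le> int N"
  shows "(\<Sum>i\<in>{1..int N}. mu i * E i a) = 0"
proof -
  have N3: "int N \<ge> 3" using N by simp
  have restrict: "(\<Sum>i\<in>{1..int N}. mu i * E i a) = (\<Sum>i\<in>S. mu i * E i a)"
    if "S \<subseteq> {1..int N}" "\<And>i. 1 \<le> i \<Longrightarrow> i \<le> int N \<Longrightarrow> i \<notin> S \<Longrightarrow> E i a = 0" for S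
    using that by (intro sum.mono_neutral_right) auto
  have near: "mu i * E i a = mu i * edge_mult N i * nr i s"
    if "1 \<le> i" "i \<le> int N" "\<bar>s\<bar> = 1" "a = i + s" for i s
    using entry_near[of i s] that a by simp
  have far: "mu i * E i a = fr i s"
    if "odd i" "1 \<le> i" "i \<le> int N" "\<bar>s\<bar> = 1" "a = i + 2 * s" for i s
    using entry_far[of i s] that a by (simp add: simpson_odd_mult)
  have ne: "mu i * edge_mult N i = (if even i then 2 else 1)" for i
    using edge_mult_pos[of N i] by (simp add: simpson_def)
  note zero = entry_zero[of _ a]
  \<comment> \<open>The units \<open>K\<close> and \<open>V\<close> absorb all divisions by the
    spacing, which leaves identities for ring normalization.\<close>
  define K where "K = D / (8 * h^2)"
  define V where "V b = w b / (4 * h)" for b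
  have K: "D / (8 * h^2) = K" "D / (4 * h^2) = 2 * K" "D / h^2 = 8 * K" by (simp_all add: K_def)
  have V: "x * w b / h = x * (4 * V b)" "x * w b / (2 * h) = x * (2 * V b)"
    "x * w b / (4 * h) = x * V b" for x b by (simp_all add: V_def)
  have V0: "V 1 = 0" "V (int N) = 0" using w_edge by (simp_all add: V_def)
  from a show ?thesis
  proof (cases rule: grid_cases)
    case 1
    have o: "odd (a - 1)" "odd (a + 1)" using 1 by auto
    have "(\<Sum>i\<in>{1..int N}. mu i * E i a) = (\<Sum>i\<in>{a - 1, a, a + 1}. mu i * E i a)"
    proof (rule restrict)
      fix i assume i: "1 \<le> i" "i \<le> int N" "i \<notin> {a - 1, a, a + 1}"
      have "\<bar>a - i\<bar> = 2 \<Longrightarrow> even i" using 1 by presburger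
      then show "E i a = 0" using i by (intro zero) auto
    qed (use 1 in auto)
    also have "\<dots> = mu (a - 1) * E (a - 1) a + mu a * E a a + mu (a + 1) * E (a + 1) a"
      by simp
    also have "\<dots> = nr (a - 1) 1 + 2 * dg a + nr (a + 1) (-1)"
      using near[of "a - 1" 1] near[of "a + 1" "-1"] 1 o a
      by (simp add: ne entry_diag simpson_even)
    also have "\<dots> = 0"
      using 1 by (simp add: near_tap_def diag_tap_def K V) (simp add: algebra_simps)
    finally show ?thesis .
  next
    case 2
    have "(\<Sum>i\<in>{1..int N}. mu i * E i a) = (\<Sum>i\<in>{1, 2, 3}. mu i * E i a)"
      by (rule restrict) (use 2 N3 in simp, intro zero, use 2 N3 in auto)
    also have "\<dots> = mu 1 * E 1 a + mu 2 * E 2 a + mu 3 * E 3 a" by simp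
    also have "\<dots> = dg 1 / 2 + 2 * nr 2 (-1) + fr 3 (-1)"
      using near[of 2 "-1"] far[of 3 "-1"] 2 N3
      by (simp add: ne entry_diag simpson_def edge_mult_def)
    also have "\<dots> = 0"
      using m_ghost by (simp add: near_tap_def diag_tap_def far_tap_def K V V0) (simp add: algebra_simps)
    finally show ?thesis .
  next
    case 3
    have "(\<Sum>i\<in>{1..int N}. mu i * E i a) = (\<Sum>i\<in>{int N, int N - 1, int N - 2}. mu i * E i a)"
      by (rule restrict) (use 3 N3 in simp, intro zero, use 3 N3 in auto)
    also have "\<dots> = mu (int N) * E (int N) a + mu (int N - 1) * E (int N - 1) a
        + mu (int N - 2) * E (int N - 2) a" by simp
    also have "\<dots> = dg (int N) / 2 + 2 * nr (int N - 1) 1 + fr (int N - 2) 1"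
      using near[of "int N - 1" 1] far[of "int N - 2" 1] 3 N3 N
      by (simp add: ne entry_diag simpson_def edge_mult_def)
    also have "\<dots> = 0"
      using m_ghost N by (simp add: near_tap_def diag_tap_def far_tap_def K V V0) (simp add: algebra_simps)
    finally show ?thesis .
  next
    case 4
    have "a \<noteq> 2" "a \<noteq> int N - 1" using 4 N by auto
    then have r: "3 \<le> a" "a \<le> int N - 2" using 4 by auto
    have e: "even (a - 1)" "even (a + 1)" using 4 by auto
    have "(\<Sum>i\<in>{1..int N}. mu i * E i a) = (\<Sum>i\<in>{a - 2, a - 1, a, a + 1, a + 2}. mu i * E i a)"
      by (rule restrict) (use r in simp, intro zero, use r in auto)
    also have "\<dots> = mu (a - 2) * E (a - 2) a + mu (a - 1) * E (a - 1) a + mu a * E a a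
        + mu (a + 1) * E (a + 1) a + mu (a + 2) * E (a + 2) a"
      by simp
    also have "\<dots> = fr (a - 2) 1 + 2 * nr (a - 1) 1 + dg a + 2 * nr (a + 1) (-1) + fr (a + 2) (-1)"
      using near[of "a - 1" 1] near[of "a + 1" "-1"] far[of "a - 2" 1] far[of "a + 2" "-1"] 4 r e a
      by (simp add: ne entry_diag simpson_def edge_mult_def)
    also have "\<dots> = 0"
      using 4 by (simp add: near_tap_def diag_tap_def far_tap_def K V) (simp add: algebra_simps)
    finally show ?thesis .
  qed
qed

lemma Z_column_sum_odd: "odd a \<Longrightarrow> (\<Sum>i\<in>{1..int N}. mu i * Z i a) = 0"
proof (rule sum.neutral, intro ballI)
  fix i assume a: "odd a"
  have "\<bar>a - i\<bar> = 1 \<Longrightarrow> even i" using a by presburger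
  then show "mu i * Z i a = 0" by (auto simp: line_z_def)
qed

text \<open>In an end row the halved weight cancels the doubled entry, so columns next to the
  boundary need no separate case.\<close>

lemma Z_column_sum_even:
  assumes a: "even a" "1 \<le> a" "a \<le> int N"
  shows "(\<Sum>i\<in>{1..int N}. mu i * Z i a) = nr (a - 1) 1 + nr (a + 1) (-1)"
proof -
  have r: "1 < a" "a < int N" using a N by (auto simp: order_less_le)
  have o: "odd (a - 1)" "odd (a + 1)" using a by auto
  have "(\<Sum>i\<in>{1..int N}. mu i * Z i a) = (\<Sum>i\<in>{a - 1, a + 1}. mu i * Z i a)"
    using r by (intro sum.mono_neutral_right) (auto simp: line_z_def)
  also have "\<dots> = mu (a - 1) * E (a - 1) a + mu (a + 1) * E (a + 1) a"
    using o by (simp add: line_z_def)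
  also have "\<dots> = nr (a - 1) 1 + nr (a + 1) (-1)"
    using entry_near[of "a - 1" 1] entry_near[of "a + 1" "-1"] r o
    by (simp add: simpson_odd_mult)
  finally show ?thesis .
qed

text \<open>All taps along a path \<open>r - s\<close>, \<open>r\<close>, \<open>r + s\<close> are
  compared with the diffusion scale \<open>P\<close> at its middle point. For constant
  \<open>m\<close> and zero \<open>w\<close> their values are -2, -1, 1/4 and 2 times
  \<open>P\<close>. Neighbouring values of \<open>m\<close> deviate by a relative 9/2000, and a
  velocity divided by \<open>h\<close> is at most \<open>P / 20\<close>. The constants are the worst
  cases, such as 2 * 1991/2000 - 1/20 = 1941/1000 and (6 * 2009/2000 - 4)/8 + 1/80 =
  265875/1000000.\<close>

lemma mid_bounds:
  assumes r: "even r" "1 \<le> r" "r \<le> int N" and s: "\<bar>s\<bar> = 1"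
  defines "P \<equiv> D / h^2 * m r"
  shows "nr (r - s) s \<le> - (1941 / 1000 * P)"
    and "nr (r - s) s \<ge> - (2059 / 1000 * P)"
    and "nr r s \<le> - (9705 / 10000 * P)"
    and "fr (r - s) s \<le> 265875 / 1000000 * P"
    and "dg r \<le> 2009 / 1000 * P"
    and "dg r \<ge> 1991 / 1000 * P"
proof -
  have ss: "s = 1 \<or> s = -1" using s by linarith
  have rr: "1 < r" "r < int N" using r N by (auto simp: order_less_le)
  define c where "c = D / h^2"
  define p where "p j = c * m j" for j
  define V where "V j = of_int s * w j / h" for j
  have c: "c > 0" using h D by (simp add: c_def)
  have Pr: "p r = P" by (simp add: p_def c_def P_def)
  have c8: "D / (8 * h^2) = c / 8" "D / (4 * h^2) = c / 4" by (simp_all add: c_def)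
  have nb: "p (r + t) \<le> 2009 / 2000 * P" "p (r + t) \<ge> 1991 / 2000 * P" if "\<bar>t\<bar> = 1" for t
  proof -
    have "t = 1 \<or> t = -1" using that by linarith
    then have "\<bar>m (r + t) - m r\<bar> \<le> 9 / 2000 * m r"
      using m_near[OF r(2,3), of t] by (auto simp: grad_tol_def)
    then have "m (r + t) \<le> 2009 / 2000 * m r" "1991 / 2000 * m r \<le> m (r + t)"
      by linarith+
    from this[THEN mult_left_mono, of c] show "p (r + t) \<le> 2009 / 2000 * P" "p (r + t) \<ge> 1991 / 2000 * P"
      using c by (simp_all add: Pr[symmetric] p_def)
  qed
  have wb: "V b \<le> P / 20" "- V b \<le> P / 20" if "\<bar>b - r\<bar> \<le> 1" for b
  proof -
    have "h * \<bar>w b\<bar> \<le> D / 20 * m r" using w_small[of r b] that r rr by auto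
    then have "h * \<bar>w b\<bar> / h^2 \<le> D / 20 * m r / h^2" using h by (intro divide_right_mono) auto
    moreover have "h * \<bar>w b\<bar> / h^2 = \<bar>V b\<bar>"
      using h ss by (auto simp: V_def power2_eq_square abs_mult)
    moreover have "D / 20 * m r / h^2 = P / 20" by (simp add: P_def)
    ultimately have "\<bar>V b\<bar> \<le> P / 20" by simp
    then show "V b \<le> P / 20" "- V b \<le> P / 20" by simp_all
  qed
  have sb: "\<bar>(r + s) - r\<bar> \<le> 1" "\<bar>r - r\<bar> \<le> 1" "\<bar>-s\<bar> = 1" using s by auto
  have o: "odd (r - s)" using r ss by auto
  have e1: "nr (r - s) s = - V r - (12 * p (r - s) + 4 * p (r + s)) / 8"
    using o by (simp add: near_tap_def c8 p_def V_def) (simp add: algebra_simps)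
  have e2: "nr r s = - V (r + s) / 2 - (p (r - s) + 3 * p (r + s)) / 4"
    using r by (simp add: near_tap_def c8 p_def V_def) (simp add: algebra_simps)
  have e3: "fr (r - s) s = V (r + s) / 4 + (3 * p (r - s) - 4 * P + 3 * p (r + s)) / 8"
    unfolding Pr[symmetric] by (simp add: far_tap_def c8 p_def V_def) (simp add: algebra_simps)
  have e4: "dg r = p (r - 1) + p (r + 1)"
    using r by (simp add: diag_tap_def c_def p_def distrib_left)
  note b = nb[OF s] nb[OF sb(3), unfolded add_uminus_conv_diff] wb[OF sb(1)] wb[OF sb(2)]
  from b show "nr (r - s) s \<le> - (1941 / 1000 * P)" "nr (r - s) s \<ge> - (2059 / 1000 * P)"
    "nr r s \<le> - (9705 / 10000 * P)" "fr (r - s) s \<le> 265875 / 1000000 * P"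
    unfolding e1 e2 e3 by (simp_all add: field_simps)
  have "p (r + 1) \<le> 2009 / 2000 * P" "p (r - 1) \<le> 2009 / 2000 * P"
    "p (r + 1) \<ge> 1991 / 2000 * P" "p (r - 1) \<ge> 1991 / 2000 * P"
    using nb[of 1] nb[of "-1"] by simp_all
  then show "dg r \<le> 2009 / 1000 * P" "dg r \<ge> 1991 / 1000 * P" by (simp_all add: e4)
qed

text \<open>The upper constant takes neighbours at 1 + 9/2000 and 1 + 18/2000 times the centre; the
  lower one keeps only the central coefficient 18/8.\<close>

lemma odd_diag_bounds:
  assumes r: "odd r" "1 \<le> r" "r \<le> int N"
  defines "P \<equiv> D / h^2 * m r"
  shows "dg r \<le> 350675 / 100000 * P" and "dg r \<ge> 9 / 4 * P"
proof -
  define c where "c = D / h^2"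
  define p where "p j = c * m j" for j
  have c: "c > 0" using h D by (simp add: c_def)
  have Pr: "p r = P" by (simp add: p_def c_def P_def)
  have P: "P > 0" using c m_pos r by (simp add: Pr[symmetric] p_def)
  have c8: "D / (8 * h^2) = c / 8" by (simp add: c_def)
  have nb: "p (r + t) \<le> k * P" "p (r + t) \<ge> 0"
    if "\<bar>t\<bar> \<le> 2" "k = 1 + of_int \<bar>t\<bar> * (9 / 2000)" for t k
  proof -
    have mr: "m r > 0" using m_pos r by simp
    have near: "\<bar>m (r + t) - m r\<bar> \<le> of_int \<bar>t\<bar> * (9 / 2000) * m r"
      using m_near[OF r(2,3), of t] that by (simp add: grad_tol_def)
    have "of_int \<bar>t\<bar> * (9 / 2000) * m r \<le> 2 * (9 / 2000) * m r"
      using that mr by (intro mult_right_mono) linarith+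
    moreover have "k * m r = m r + of_int \<bar>t\<bar> * (9 / 2000) * m r"
      using that by (simp add: algebra_simps)
    ultimately have "m (r + t) \<le> k * m r" "0 \<le> m (r + t)"
      using near mr by linarith+
    from this[THEN mult_left_mono, of c] show "p (r + t) \<le> k * P" "p (r + t) \<ge> 0"
      using c by (simp_all add: Pr[symmetric] p_def mult.left_commute)
  qed
  have e: "dg r = (p (r - 2) + 4 * p (r - 1) + 18 * P + 4 * p (r + 1) + p (r + 2)) / 8"
    using r unfolding Pr[symmetric] by (simp add: diag_tap_def c8 p_def) (simp add: algebra_simps)
  have "p (r + 1) \<le> 2009 / 2000 * P" "p (r - 1) \<le> 2009 / 2000 * P"
    "p (r + 2) \<le> 2018 / 2000 * P" "p (r - 2) \<le> 2018 / 2000 * P"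
    "p (r + 1) \<ge> 0" "p (r - 1) \<ge> 0" "p (r + 2) \<ge> 0" "p (r - 2) \<ge> 0"
    using nb[of 1 "2009 / 2000"] nb[of "-1" "2009 / 2000"] nb[of 2 "2018 / 2000"] nb[of "-2" "2018 / 2000"]
    by simp_all
  with P show "dg r \<le> 350675 / 100000 * P" "dg r \<ge> 9 / 4 * P"
    unfolding e by (simp_all add: field_simps)
qed

lemma diag_pos:
  assumes r: "1 \<le> r" "r \<le> int N" shows "dg r > 0"
proof (cases "even r")
  case True
  have "0 < 1991 / 1000 * (D / h^2 * m r)" using h D m_pos r by simp
  then show ?thesis by (rule less_le_trans) (use mid_bounds(6)[of r 1] True r in simp)
next
  case False
  have "0 < 9 / 4 * (D / h^2 * m r)" using h D m_pos r by simp
  then show ?thesis by (rule less_le_trans) (use odd_diag_bounds(2)[of r] False r in simp)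
qed

text \<open>Every near step has exactly one even endpoint, and the bounds relative to that point
  apply.\<close>

lemma near_neg:
  assumes "1 \<le> i" "i \<le> int N" "1 \<le> i + s" "i + s \<le> int N" "\<bar>s\<bar> = 1"
  shows "nr i s < 0"
proof (cases "even i")
  case True
  have "- (9705 / 10000 * (D / h^2 * m i)) < 0" using h D m_pos assms by simp
  then show ?thesis by (rule le_less_trans[OF mid_bounds(3)[OF True assms(1,2,5)]])
next
  case False
  have e: "even (i + s)" using False assms(5) by presburger
  have "- (1941 / 1000 * (D / h^2 * m (i + s))) < 0" using h D m_pos assms by simp
  from le_less_trans[OF mid_bounds(1)[OF e assms(3,4,5)] this] show ?thesis by simp
qed

lemma entry_near_neg:
  assumes "1 \<le> i" "i \<le> int N" "1 \<le> a" "a \<le> int N" "\<bar>a - i\<bar> = 1"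
  shows "E i a < 0"
  using entry_near[of i "a - i"] near_neg[of i "a - i"] edge_mult_pos[of N i] assms
  by (simp add: mult_pos_neg)

end

section \<open>The two-dimensional scheme\<close>

text \<open>Condition (2) for a single path. Row \<open>r - s\<close> has the same edge factor on
  both sides, and what remains after the bound on \<open>d\<close> is 0.265875 * 6.94 <= 1.941 *
  0.9705. The limit here would be about 7.08, while the diagonals met later need 6.93005; 6.94 lies
  between.\<close>

lemma (in scheme_line) far_path_bound:
  assumes r: "even r" "1 \<le> r" "r \<le> int N" and s: "\<bar>s\<bar> = 1"
    and t: "t > 0" and \<theta>: "\<theta> > 0" and d: "d > 0" "d \<le> 694 / 100 * \<theta> * t * (D / h^2 * m r)"
  shows "t * E (r - s) (r + s) \<le> t * \<theta> * E (r - s) r * (t * E r (r + s)) / d"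
proof -
  define P where "P = D / h^2 * m r"
  have P: "P > 0" using h D m_pos r by (simp add: P_def)
  have ss: "s = 1 \<or> s = -1" using s by linarith
  have rr: "1 < r" "r < int N" using r N by (auto simp: order_less_le)
  have o: "odd (r - s)" using r ss by auto
  let ?k = "edge_mult N (r - s)"
  have e: "E (r - s) (r + s) = ?k * fr (r - s) s" "E (r - s) r = ?k * nr (r - s) s" "E r (r + s) = nr r s"
    using entry_far[of "r - s" s] entry_near[of "r - s" s] entry_near[of r s] o rr ss s
    by (auto simp: edge_mult_even r add.commute)
  have b1: "1941 / 1000 * P \<le> - nr (r - s) s" and b2: "9705 / 10000 * P \<le> - nr r s"
    and b3: "fr (r - s) s \<le> 265875 / 1000000 * P"
    using mid_bounds[OF r s] unfolding P_def[symmetric] by simp_all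
  have "fr (r - s) s * d \<le> 265875 / 1000000 * P * d"
    using b3 d by (intro mult_right_mono) auto
  also have "\<dots> \<le> 265875 / 1000000 * P * (694 / 100 * \<theta> * t * P)"
    using d P unfolding P_def[symmetric] by (intro mult_left_mono) auto
  also have "\<dots> = (265875 / 1000000 * (694 / 100)) * (\<theta> * t * (P * P))" by simp
  also have "\<dots> \<le> (1941 / 1000 * (9705 / 10000)) * (\<theta> * t * (P * P))"
    using \<theta> t P by (intro mult_right_mono) auto
  also have "\<dots> = \<theta> * t * ((1941 / 1000 * P) * (9705 / 10000 * P))" by simp
  also have "\<dots> \<le> \<theta> * t * ((- nr (r - s) s) * (- nr r s))"
    using b1 b2 P \<theta> t by (intro mult_left_mono mult_mono) auto
  also have "\<dots> = t * \<theta> * nr (r - s) s * nr r s" by simp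
  finally have "fr (r - s) s \<le> t * \<theta> * nr (r - s) s * nr r s / d"
    using d by (simp add: pos_le_divide_eq)
  then have "(t * ?k) * fr (r - s) s \<le> (t * ?k) * (t * \<theta> * nr (r - s) s * nr r s / d)"
    using t edge_mult_pos[of N "r - s"] by (intro mult_left_mono) auto
  then show ?thesis unfolding e by (simp add: mult_ac)
qed

text \<open>Distinct points share at most one grid line, so off the diagonal at most one of the two
  line terms is nonzero.\<close>

definition grid_entry where
  "grid_entry N h D t M u v i j a b =
     (if a = i \<and> b = j then M i j else 0)
     + t * (if b = j then line_entry N h D (\<lambda>i. M i j) (\<lambda>i. u i j) i a else 0)
     + t * (if a = i then line_entry N h D (\<lambda>j. M i j) (\<lambda>j. v i j) j b else 0)"

text \<open>When the other coordinate is even, taking the whole entry would destroy the strict positivity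
  of the column sums of \<open>A\<^sub>d + A\<^sup>z\<close> at the cell centres; when it is odd, nothing smaller than
  almost the whole entry suffices for condition (2).\<close>

definition share :: "int \<Rightarrow> real" where
  "share j = (if odd j then 1 else 4 / 5)"

definition grid_z where
  "grid_z N h D t M u v i j a b =
     t * (if b = j then share j * line_z N h D (\<lambda>i. M i j) (\<lambda>i. u i j) i a else 0)
     + t * (if a = i then share i * line_z N h D (\<lambda>j. M i j) (\<lambda>j. v i j) j b else 0)"

locale scheme_grid =
  fixes N :: nat and h D t :: real and M u v :: "int \<Rightarrow> int \<Rightarrow> real"
  assumes line_x: "\<And>j. 1 \<le> j \<Longrightarrow> j \<le> int N \<Longrightarrow> scheme_line N h D (\<lambda>i. M i j) (\<lambda>i. u i j)"
    and line_y: "\<And>i. 1 \<le> i \<Longrightarrow> i \<le> int N \<Longrightarrow> scheme_line N h D (\<lambda>j. M i j) (\<lambda>j. v i j)"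
    and t: "t > 0" and step: "h^2 \<le> sqrt 2 * t * D" and N3: "N \<ge> 3"
begin

abbreviation "A \<equiv> grid_entry N h D t M u v"
abbreviation "Az \<equiv> grid_z N h D t M u v"
abbreviation "mu \<equiv> simpson N"

text \<open>The symmetry under exchange of coordinates, which reduces paths along the second
  coordinate to paths along the first.\<close>

lemma swap: "scheme_grid N h D t (\<lambda>i j. M j i) (\<lambda>i j. v j i) (\<lambda>i j. u j i)"
  by (rule scheme_grid.intro) (use line_x line_y t step N3 in blast)+

lemma entry_swap: "grid_entry N h D t (\<lambda>i j. M j i) (\<lambda>i j. v j i) (\<lambda>i j. u j i) j i b a = A i j a b"
  by (simp add: grid_entry_def)

lemma z_swap: "grid_z N h D t (\<lambda>i j. M j i) (\<lambda>i j. v j i) (\<lambda>i j. u j i) j i b a = Az i j a b"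
  by (simp add: grid_z_def)

lemma h: "h > 0" and D: "D > 0"
  using line_x[of 1] N3 unfolding scheme_line_def by auto

lemma M_pos: "1 \<le> i \<Longrightarrow> i \<le> int N \<Longrightarrow> 1 \<le> j \<Longrightarrow> j \<le> int N \<Longrightarrow> M i j > 0"
  using scheme_line.m_pos[OF line_x] by blast

lemma share_pos: "share j > 0"
  by (simp add: share_def)

lemma simpson_even: "even i \<Longrightarrow> mu i = 2"
  using scheme_line.simpson_even[OF line_x[of 1]] N3 by simp

lemma diag_entry:
  assumes "1 \<le> i" "i \<le> int N" "1 \<le> j" "j \<le> int N"
  shows "A i j i j = M i j + t * diag_tap h D (\<lambda>i. M i j) i + t * diag_tap h D (\<lambda>j. M i j) j"
  using assms scheme_line.entry_diag[OF line_x] scheme_line.entry_diag[OF line_y]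
  by (simp add: grid_entry_def)

lemma diag_entry_pos:
  assumes "1 \<le> i" "i \<le> int N" "1 \<le> j" "j \<le> int N"
  shows "A i j i j > 0"
  unfolding diag_entry[OF assms]
  using assms t M_pos scheme_line.diag_pos[OF line_x] scheme_line.diag_pos[OF line_y]
  by (simp add: add_pos_pos)

lemma z_diag: "Az i j i j = 0"
  by (simp add: grid_z_def line_z_def)

text \<open>The second claim says that removing the share from a negative entry leaves something
  nonpositive; this is the sign condition on A^s.\<close>

lemma z_bounds:
  assumes "1 \<le> i" "i \<le> int N" "1 \<le> j" "j \<le> int N" "1 \<le> a" "a \<le> int N" "1 \<le> b" "b \<le> int N"
  shows "Az i j a b \<le> 0" and "Az i j a b \<noteq> 0 \<Longrightarrow> A i j a b \<le> Az i j a b"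
proof -
  have sh: "y \<le> share k * y" "share k * y \<le> 0" if "y < 0" for k y
    using that by (auto simp: share_def mult_nonneg_nonpos)
  have ts: "t * y \<le> t * (share k * y)" "t * (share k * y) \<le> 0" if "y < 0" for k y
    using sh[OF that, of k] t by (auto intro: mult_nonneg_nonpos)
  have x: "line_entry N h D (\<lambda>i. M i j) (\<lambda>i. u i j) i a < 0" if "\<bar>a - i\<bar> = 1"
    using scheme_line.entry_near_neg[OF line_x] assms that by blast
  have y: "line_entry N h D (\<lambda>j. M i j) (\<lambda>j. v i j) j b < 0" if "\<bar>b - j\<bar> = 1"
    using scheme_line.entry_near_neg[OF line_y] assms that by blast
  show "Az i j a b \<le> 0" "Az i j a b \<noteq> 0 \<Longrightarrow> A i j a b \<le> Az i j a b"
    using ts[OF x] ts[OF y] by (auto simp: grid_z_def grid_entry_def line_z_def split: if_splits)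
qed

section \<open>Weighted column sums on the grid\<close>

lemma sum_line_x:
  assumes "1 \<le> b" "b \<le> int N"
  shows "(\<Sum>i\<in>{1..int N}. \<Sum>j\<in>{1..int N}. mu i * mu j * (t * (if b = j then F j i else 0)))
    = t * mu b * (\<Sum>i\<in>{1..int N}. mu i * F b i)"
proof -
  have "(\<Sum>j\<in>{1..int N}. mu i * mu j * (t * (if b = j then F j i else 0))) = t * mu b * (mu i * F b i)" for i
  proof -
    have "(\<Sum>j\<in>{1..int N}. mu i * mu j * (t * (if b = j then F j i else 0)))
        = (\<Sum>j\<in>{1..int N}. if b = j then mu i * mu j * (t * F j i) else 0)"
      by (intro sum.cong) auto
    also have "\<dots> = mu i * mu b * (t * F b i)" using assms by simp
    finally show ?thesis by (simp add: mult_ac)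
  qed
  then show ?thesis by (simp add: sum_distrib_left)
qed

lemma sum_line_y:
  assumes "1 \<le> a" "a \<le> int N"
  shows "(\<Sum>i\<in>{1..int N}. \<Sum>j\<in>{1..int N}. mu i * mu j * (t * (if a = i then F i j else 0)))
    = t * mu a * (\<Sum>j\<in>{1..int N}. mu j * F a j)"
  using sum_line_x[OF assms, of F] by (subst sum.swap) (simp add: mult.commute[of "mu _" "mu _"])

lemma column_sum_entry:
  assumes ab: "1 \<le> a" "a \<le> int N" "1 \<le> b" "b \<le> int N"
  shows "(\<Sum>i\<in>{1..int N}. \<Sum>j\<in>{1..int N}. mu i * mu j * A i j a b) = mu a * mu b * M a b"
proof -
  have "(\<Sum>i\<in>{1..int N}. \<Sum>j\<in>{1..int N}. mu i * mu j * (if a = i \<and> b = j then M i j else 0))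
      = (\<Sum>i\<in>{1..int N}. if a = i then mu i * mu b * M i b else 0)"
    using ab by (intro sum.cong) (auto simp: if_distrib[of "\<lambda>x. _ * x"] cong: if_cong)
  also have "\<dots> = mu a * mu b * M a b" using ab by simp
  finally show ?thesis
    unfolding grid_entry_def distrib_left sum.distrib sum_line_x[OF ab(3,4)] sum_line_y[OF ab(1,2)]
    using scheme_line.column_sum[OF line_x[OF ab(3,4)] ab(1,2)]
      scheme_line.column_sum[OF line_y[OF ab(1,2)] ab(3,4)]
    by (simp add: eq_commute[of a] eq_commute[of b])
qed

text \<open>First steps arrive only in directions whose coordinate is even: in none at a cell
  corner, one at an edge midpoint, both at a cell centre. The constant 4118/1000 is twice 2059/1000,
  for arrivals from two sides.\<close>

lemma column_sum_z:
  assumes ab: "1 \<le> a" "a \<le> int N" "1 \<le> b" "b \<le> int N"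
  shows "mu a * mu b * A a b a b + (\<Sum>i\<in>{1..int N}. \<Sum>j\<in>{1..int N}. mu i * mu j * Az i j a b) > 0"
proof -
  define Q where "Q = D / h^2 * M a b"
  define P where "P = t * Q"
  have Q: "Q > 0" using h D M_pos ab by (simp add: Q_def)
  have P: "P > 0" using t Q by (simp add: P_def)
  have scale: "k * P \<le> t * x" if "k * Q \<le> x" for k x
    using mult_left_mono[OF that, of t] t by (simp add: P_def mult.left_commute)
  define Sx where "Sx = (\<Sum>i\<in>{1..int N}. mu i * line_z N h D (\<lambda>i. M i b) (\<lambda>i. u i b) i a)"
  define Sy where "Sy = (\<Sum>j\<in>{1..int N}. mu j * line_z N h D (\<lambda>j. M a j) (\<lambda>j. v a j) j b)"
  define dx where "dx = diag_tap h D (\<lambda>i. M i b) a"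
  define dy where "dy = diag_tap h D (\<lambda>j. M a j) b"
  note lx = line_x[OF ab(3,4)] and ly = line_y[OF ab(1,2)]
  have x0: "Sx = 0" if "odd a"
    unfolding Sx_def using scheme_line.Z_column_sum_odd[OF lx that] .
  have y0: "Sy = 0" if "odd b"
    unfolding Sy_def using scheme_line.Z_column_sum_odd[OF ly that] .
  have x1: "Sx \<ge> - (4118 / 1000) * Q" if "even a"
    unfolding Sx_def scheme_line.Z_column_sum_even[OF lx that ab(1,2)]
    using scheme_line.mid_bounds(2)[OF lx that ab(1,2), of 1]
      scheme_line.mid_bounds(2)[OF lx that ab(1,2), of "-1"]
    by (simp add: Q_def)
  have y1: "Sy \<ge> - (4118 / 1000) * Q" if "even b"
    unfolding Sy_def scheme_line.Z_column_sum_even[OF ly that ab(3,4)]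
    using scheme_line.mid_bounds(2)[OF ly that ab(3,4), of 1]
      scheme_line.mid_bounds(2)[OF ly that ab(3,4), of "-1"]
    by (simp add: Q_def)
  have dx0: "dx \<ge> 9 / 4 * Q" if "odd a"
    using scheme_line.odd_diag_bounds(2)[OF lx that ab(1,2)] by (simp only: dx_def Q_def)
  have dy0: "dy \<ge> 9 / 4 * Q" if "odd b"
    using scheme_line.odd_diag_bounds(2)[OF ly that ab(3,4)] by (simp only: dy_def Q_def)
  have dx1: "dx \<ge> 1991 / 1000 * Q" if "even a"
    using scheme_line.mid_bounds(6)[OF lx that ab(1,2) abs_one] by (simp only: dx_def Q_def)
  have dy1: "dy \<ge> 1991 / 1000 * Q" if "even b"
    using scheme_line.mid_bounds(6)[OF ly that ab(3,4) abs_one] by (simp only: dy_def Q_def)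
  have sz: "(\<Sum>i\<in>{1..int N}. \<Sum>j\<in>{1..int N}. mu i * mu j * Az i j a b)
      = mu b * share b * (t * Sx) + mu a * share a * (t * Sy)"
    unfolding grid_z_def distrib_left sum.distrib sum_line_x[OF ab(3,4)] sum_line_y[OF ab(1,2)]
      mult.left_commute[of _ "share _"] sum_distrib_left[symmetric] Sx_def Sy_def
    by (simp add: mult_ac)
  have M: "M a b > 0" using M_pos ab by simp
  have "mu a * mu b * (M a b + t * dx + t * dy)
      + (mu b * share b * (t * Sx) + mu a * share a * (t * Sy)) > 0"
  proof (cases "even a"; cases "even b")
    \<comment> \<open>The gain 8 * 1991/1000 exceeds the loss 2 * (8/5) * 4118/1000, where 8/5 is
      the weight 2 times the share 4/5. With full shares the loss 4 * 4118/1000 would be larger than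
      this gain.\<close>
    assume e: "even a" "even b"
    have "8 / 5 * (t * Sx) + 8 / 5 * (t * Sy) + 4 * M a b + 4 * (t * dx) + 4 * (t * dy) > 0"
      using scale[OF x1[OF e(1)]] scale[OF y1[OF e(2)]] scale[OF dx1[OF e(1)]] scale[OF dy1[OF e(2)]] M P
      by linarith
    then show ?thesis using e by (simp add: simpson_even share_def algebra_simps)
  next
    assume e: "even a" "odd b"
    have "2 * M a b + 2 * (t * dx) + 2 * (t * dy) + t * Sx > 0"
      using scale[OF x1[OF e(1)]] scale[OF dx1[OF e(1)]] scale[OF dy0[OF e(2)]] M P by linarith
    \<comment> \<open>The weight in the odd coordinate may be 1 or 1/2; being a common factor, it is
      restored only here.\<close>
    from mult_pos_pos[OF simpson_pos[of N b] this] show ?thesis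
      using e y0 by (simp add: simpson_even share_def algebra_simps)
  next
    assume e: "odd a" "even b"
    have "2 * M a b + 2 * (t * dx) + 2 * (t * dy) + t * Sy > 0"
      using scale[OF y1[OF e(2)]] scale[OF dx0[OF e(1)]] scale[OF dy1[OF e(2)]] M P by linarith
    from mult_pos_pos[OF simpson_pos[of N a] this] show ?thesis
      using e x0 by (simp add: simpson_even share_def algebra_simps)
  next
    assume e: "odd a" "odd b"
    have "M a b + t * dx + t * dy > 0"
      using scale[OF dx0[OF e(1)]] scale[OF dy0[OF e(2)]] M P by linarith
    then show ?thesis using e x0 y0 simpson_pos by simp
  qed
  then show ?thesis unfolding sz diag_entry[OF ab] dx_def dy_def .
qed

text \<open>Condition (d) absorbs the mass term into the diffusion scale; 14143/10000 lies just
  above sqrt 2.\<close>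

lemma step_bound:
  assumes "1 \<le> a" "a \<le> int N" "1 \<le> b" "b \<le> int N"
  shows "M a b \<le> 14143 / 10000 * t * (D / h^2 * M a b)"
proof -
  have "sqrt 2 \<le> 14143 / 10000" by (rule real_le_lsqrt) (simp_all add: power2_eq_square)
  then have "sqrt 2 * (t * D) \<le> 14143 / 10000 * (t * D)" using t D by (intro mult_right_mono) auto
  then have "h^2 \<le> 14143 / 10000 * t * D" using step by simp
  then have "1 \<le> 14143 / 10000 * t * D / h^2" using h by (simp add: pos_le_divide_eq)
  from mult_right_mono[OF this, of "M a b"] show ?thesis using M_pos[OF assms] by simp
qed

text \<open>Mass, own line and cross line add up to 1.4143 + 2.009 + 3.50675 = 6.93005 for odd
  \<open>b\<close>, and to 1.4143 + 2 * 2.009 = 5.4323 <= 6.94 * 4/5 for even \<open>b\<close>. The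
  smaller cross term is what permits the reduced share.\<close>

lemma mid_diag_entry_le:
  assumes ab: "even a" "1 \<le> a" "a \<le> int N" "1 \<le> b" "b \<le> int N"
  shows "A a b a b \<le> 694 / 100 * share b * t * (D / h^2 * M a b)"
proof -
  define Q where "Q = D / h^2 * M a b"
  define P where "P = t * Q"
  have Q: "Q > 0" using h D M_pos ab by (simp add: Q_def)
  have P: "P > 0" using t Q by (simp add: P_def)
  have scale: "t * x \<le> k * P" if "x \<le> k * Q" for k x
    using mult_left_mono[OF that, of t] t by (simp add: P_def mult.left_commute)
  note lx = line_x[OF ab(4,5)] and ly = line_y[OF ab(2,3)]
  have m: "M a b \<le> 14143 / 10000 * P"
    using step_bound[OF ab(2-5)] by (simp only: P_def Q_def mult.assoc)
  have x: "t * diag_tap h D (\<lambda>i. M i b) a \<le> 2009 / 1000 * P"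
    using scheme_line.mid_bounds(5)[OF lx ab(1-3) abs_one] by (intro scale) (simp only: Q_def)
  have "A a b a b \<le> 694 / 100 * share b * P"
  proof (cases "even b")
    case True
    have "t * diag_tap h D (\<lambda>j. M a j) b \<le> 2009 / 1000 * P"
      using scheme_line.mid_bounds(5)[OF ly True ab(4,5) abs_one] by (intro scale) (simp only: Q_def)
    then have "A a b a b \<le> 694 / 100 * (4 / 5) * P"
      unfolding diag_entry[OF ab(2-5)] using m x P by linarith
    then show ?thesis using True by (simp add: share_def)
  next
    case False
    have "t * diag_tap h D (\<lambda>j. M a j) b \<le> 350675 / 100000 * P"
      using scheme_line.odd_diag_bounds(1)[OF ly False ab(4,5)] by (intro scale) (simp only: Q_def)
    then have "A a b a b \<le> 694 / 100 * P"
      unfolding diag_entry[OF ab(2-5)] using m x P by linarith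
    then show ?thesis using False by (simp add: share_def)
  qed
  then show ?thesis by (simp only: P_def Q_def mult.assoc)
qed

text \<open>Near entries are negative, so a positive entry comes from a far tap of an odd row, and
  the point in between has even index. The second step thus starts where \<open>line_z\<close>
  vanishes and belongs wholly to A^s; the clauses on \<open>A x y a j\<close> and
  \<open>Az x y a j\<close> record this.\<close>

lemma positive_entry_path_x:
  assumes ij: "1 \<le> i" "i \<le> int N" "1 \<le> j" "j \<le> int N" and a: "1 \<le> a" "a \<le> int N" "a \<noteq> i"
    and pos: "A i j a j > 0"
  shows "\<exists>x y. 1 \<le> x \<and> x \<le> int N \<and> 1 \<le> y \<and> y \<le> int N \<and> (x, y) \<noteq> (a, j) \<and> A x y a j < 0
    \<and> Az x y a j = 0 \<and> A i j a j \<le> Az i j x y * A x y a j / A x y x y"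
proof -
  let ?E = "line_entry N h D (\<lambda>i. M i j) (\<lambda>i. u i j)"
  note lx = line_x[OF ij(3,4)]
  have Ex: "A i' j a' j = t * ?E i' a'" if "a' \<noteq> i'" for i' a'
    using that by (simp add: grid_entry_def)
  have "?E i a > 0" using pos t a by (simp add: Ex zero_less_mult_iff)
  then have "\<bar>a - i\<bar> \<noteq> 1" "odd i \<and> \<bar>a - i\<bar> = 2"
    using scheme_line.entry_near_neg[OF lx ij(1,2) a(1,2)] scheme_line.entry_zero[OF lx ij(1,2) a(3)]
    by force+
  then have o: "odd i" and d2: "a = i + 2 \<or> a = i - 2" by linarith+
  define s where "s = (if a = i + 2 then 1 else - 1 :: int)"
  have s: "\<bar>s\<bar> = 1" and as: "a = i + 2 * s" using d2 by (auto simp: s_def)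
  define r where "r = i + s"
  have r: "even r" "1 \<le> r" "r \<le> int N" using o s ij a d2 by (auto simp: r_def s_def)
  have ra: "i = r - s" "a = r + s" "a \<noteq> r" "r \<noteq> i" "\<bar>a - r\<bar> = 1" "\<bar>r - i\<bar> = 1"
    using as s by (auto simp: r_def)
  have neg: "A r j a j < 0"
    using scheme_line.entry_near_neg[OF lx r(2,3) a(1,2) ra(5)] t ra(3) by (simp add: Ex mult_pos_neg)
  have z0: "Az r j a j = 0" using r ra(3) by (simp add: grid_z_def line_z_def)
  have z: "Az i j r j = t * share j * ?E i r"
    using ra(4,6) o by (simp add: grid_z_def line_z_def)
  have "t * ?E (r - s) (r + s) \<le> t * share j * ?E (r - s) r * (t * ?E r (r + s)) / A r j r j"
    by (rule scheme_line.far_path_bound[OF lx r s t share_pos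
          diag_entry_pos[OF r(2,3) ij(3,4)] mid_diag_entry_le[OF r ij(3,4)]])
  then have "A i j a j \<le> Az i j r j * A r j a j / A r j r j"
    unfolding Ex[OF a(3)] Ex[OF ra(3)] z ra(1,2)[symmetric] .
  then show ?thesis using r ij ra(3) neg z0 by (intro exI[of _ r] exI[of _ j]) auto
qed

lemma positive_entry_path:
  assumes ij: "1 \<le> i" "i \<le> int N" "1 \<le> j" "j \<le> int N"
    and ab: "1 \<le> a" "a \<le> int N" "1 \<le> b" "b \<le> int N"
    and ne: "(i, j) \<noteq> (a, b)" and pos: "A i j a b > 0"
  shows "\<exists>x y. 1 \<le> x \<and> x \<le> int N \<and> 1 \<le> y \<and> y \<le> int N \<and> (x, y) \<noteq> (a, b) \<and> A x y a b < 0
    \<and> Az x y a b = 0 \<and> A i j a b \<le> Az i j x y * A x y a b / A x y x y"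
proof -
  have "b = j \<or> a = i" using pos by (auto simp: grid_entry_def split: if_splits)
  then consider "b = j" "a \<noteq> i" | "a = i" "b \<noteq> j" using ne by auto
  then show ?thesis
  proof cases
    case 1
    then show ?thesis using positive_entry_path_x[OF ij ab(1,2)] pos by simp
  next
    case 2
    with scheme_grid.positive_entry_path_x[OF swap ij(3,4,1,2) ab(3,4)] pos
    obtain y x where "1 \<le> x" "x \<le> int N" "1 \<le> y" "y \<le> int N" "(y, x) \<noteq> (b, i)" "A x y i b < 0"
      "Az x y i b = 0" "A i j i b \<le> Az i j x y * A x y i b / A x y x y"
      unfolding entry_swap z_swap by blast
    with 2 show ?thesis by (intro exI[of _ x] exI[of _ y]) auto
  qed
qed

section \<open>Numbering of the grid points and passage to matrices\<close>

lemma idx_cases: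
  assumes "p < N * N"
  obtains i j where "idx N p = (i, j)" "1 \<le> i" "i \<le> int N" "1 \<le> j" "j \<le> int N"
proof
  show "idx N p = (int (p div N) + 1, int (p mod N) + 1)" by (simp add: idx_def)
  have "p div N < N" "p mod N < N" using less_mult_imp_div_less[OF assms] N3 by simp_all
  then have *: "int (p div N) < int N" "int (p mod N) < int N" by (simp_all only: of_nat_less_iff)
  show "int (p div N) + 1 \<le> int N" by (rule zless_imp_add1_zle[OF *(1)])
  show "int (p mod N) + 1 \<le> int N" by (rule zless_imp_add1_zle[OF *(2)])
qed auto

lemma idx_inj: "idx N p = idx N q \<Longrightarrow> p = q"
  by (metis Pair_inject add_right_cancel div_mult_mod_eq idx_def of_nat_eq_iff)

lemma idx_surj:
  assumes "1 \<le> i" "i \<le> int N" "1 \<le> j" "j \<le> int N"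
  obtains p where "p < N * N" "idx N p = (i, j)"
proof
  have a: "nat (i - 1) < N" "nat (j - 1) < N" using assms by auto
  then have "nat (i - 1) * N + nat (j - 1) < (nat (i - 1) + 1) * N" by simp
  also have "\<dots> \<le> N * N" using a by (intro mult_le_mono1) auto
  finally show "nat (i - 1) * N + nat (j - 1) < N * N" .
  show "idx N (nat (i - 1) * N + nat (j - 1)) = (i, j)" using a assms by (simp add: idx_def)
qed

lemma sum_idx: "(\<Sum>p<N * N. f (idx N p)) = (\<Sum>i\<in>{1..int N}. \<Sum>j\<in>{1..int N}. f (i, j))"
proof -
  have "bij_betw (idx N) {..<N * N} ({1..int N} \<times> {1..int N})"
    unfolding bij_betw_def
  proof (intro conjI subset_antisym subsetI)
    show "inj_on (idx N) {..<N * N}" by (intro inj_onI idx_inj)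
  next
    fix x assume "x \<in> idx N ` {..<N * N}"
    then obtain p where "p < N * N" "x = idx N p" by blast
    then show "x \<in> {1..int N} \<times> {1..int N}" by (elim idx_cases) simp
  next
    fix x assume "x \<in> {1..int N} \<times> {1..int N}"
    then obtain i j where "x = (i, j)" "1 \<le> i" "i \<le> int N" "1 \<le> j" "j \<le> int N" by auto
    moreover from idx_surj[OF this(2-5)] obtain p where "p < N * N" "idx N p = (i, j)" .
    ultimately show "x \<in> idx N ` {..<N * N}" by (metis imageI lessThan_iff)
  qed
  from sum.reindex_bij_betw[OF this, of f] show ?thesis by (simp add: sum.cartesian_product)
qed

lemma coeff_mat_entry:
  assumes p: "p < N * N" "idx N p = (i, j)" and q: "q < N * N" "idx N q = (a, b)"
  shows "coeff_mat N h D t M u v $$ (p, q) = A i j a b"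
proof -
  have ij: "1 \<le> i" "i \<le> int N" "1 \<le> j" "j \<le> int N" using idx_cases[OF p(1)] p(2) by auto
  have r: "reflect N i = i" "reflect N j = j" using ij by (simp_all add: reflect_def)
  have ext: "even_ext N (unit_grid N q) x y = (if reflect N x = a \<and> reflect N y = b then 1 else 0)" for x y
    by (simp add: even_ext_def unit_grid_def q)
  have zero: "stencil h D m w (\<lambda>_. 0) k = 0" for m w k
    by (simp add: stencil_def conv_odd_def conv_even_def)
  have "X_op h D M u (even_ext N (unit_grid N q)) i j
      = (if b = j then line_entry N h D (\<lambda>i. M i j) (\<lambda>i. u i j) i a else 0)"
    by (auto simp: X_op_def line_entry_def ext r zero)
  moreover have "Y_op h D M v (even_ext N (unit_grid N q)) i j
      = (if a = i then line_entry N h D (\<lambda>j. M i j) (\<lambda>j. v i j) j b else 0)"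
    by (auto simp: Y_op_def line_entry_def ext r zero)
  ultimately show ?thesis
    using p q by (auto simp: coeff_mat_def scheme_lhs_def grid_entry_def unit_grid_def)
qed

lemma lorenz:
  defines "C \<equiv> coeff_mat N h D t M u v"
  shows "lorenz_conditions C"
    and "\<exists>P Q. P \<in> carrier_mat (N * N) (N * N) \<and> Q \<in> carrier_mat (N * N) (N * N)
      \<and> M_matrix P \<and> M_matrix Q \<and> C = P * Q"
    and "monotone_mat C"
proof -
  let ?n = "N * N"
  define Z where "Z = mat ?n ?n (\<lambda>(p, q). case idx N p of (i, j) \<Rightarrow> case idx N q of (a, b) \<Rightarrow> Az i j a b)"
  define S where "S = neg_offdiag C - Z"
  define W where "W p = (case idx N p of (i, j) \<Rightarrow> mu i * mu j)" for p
  have C: "C \<in> carrier_mat ?n ?n" by (simp add: C_def coeff_mat_def)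
  have Z: "Z \<in> carrier_mat ?n ?n" by (simp add: Z_def)
  have n: "?n > 0" using N3 by simp
  have Ce: "C $$ (p, q) = A i j a b" if "p < ?n" "q < ?n" "idx N p = (i, j)" "idx N q = (a, b)" for p q i j a b
    unfolding C_def using coeff_mat_entry that by blast
  have Ze: "Z $$ (p, q) = Az i j a b" if "p < ?n" "q < ?n" "idx N p = (i, j)" "idx N q = (a, b)" for p q i j a b
    using that by (simp add: Z_def)
  have Se: "S $$ (p, q) = (if p \<noteq> q \<and> C $$ (p, q) < 0 then C $$ (p, q) else 0) - Z $$ (p, q)"
    if "p < ?n" "q < ?n" for p q
    using that C Z by (simp add: S_def neg_offdiag_def diag_part_def pos_offdiag_def)
  have diag: "C $$ (p, p) > 0" if p: "p < ?n" for p
  proof -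
    obtain i j where ij: "idx N p = (i, j)" "1 \<le> i" "i \<le> int N" "1 \<le> j" "j \<le> int N"
      using idx_cases[OF p] .
    show ?thesis using diag_entry_pos[OF ij(2-5)] by (simp add: Ce[OF p p ij(1) ij(1)])
  qed
  have ZS: "Z $$ (p, q) \<le> 0" "S $$ (p, q) \<le> 0" if pq: "p < ?n" "q < ?n" for p q
  proof -
    obtain i j where ij: "idx N p = (i, j)" "1 \<le> i" "i \<le> int N" "1 \<le> j" "j \<le> int N"
      using idx_cases[OF pq(1)] .
    obtain a b where ab: "idx N q = (a, b)" "1 \<le> a" "a \<le> int N" "1 \<le> b" "b \<le> int N"
      using idx_cases[OF pq(2)] .
    note c = Ce[OF pq ij(1) ab(1)] and z = Ze[OF pq ij(1) ab(1)]
    note bd = z_bounds[OF ij(2-5) ab(2-5)]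
    show "Z $$ (p, q) \<le> 0" using bd z by simp
    have "p = q \<Longrightarrow> Az i j a b = 0" using ij ab z_diag by simp
    then show "S $$ (p, q) \<le> 0" using bd unfolding Se[OF pq] c z by (cases "Az i j a b = 0") auto
  qed
  have pos: "C $$ (p, q) \<le> (\<Sum>r<?n. Z $$ (p, r) * S $$ (r, q) / C $$ (r, r))"
    if pq: "p < ?n" "q < ?n" "p \<noteq> q" and gt: "C $$ (p, q) > 0" for p q
  proof -
    obtain i j where ij: "idx N p = (i, j)" "1 \<le> i" "i \<le> int N" "1 \<le> j" "j \<le> int N"
      using idx_cases[OF pq(1)] .
    obtain a b where ab: "idx N q = (a, b)" "1 \<le> a" "a \<le> int N" "1 \<le> b" "b \<le> int N"
      using idx_cases[OF pq(2)] .
    have "(i, j) \<noteq> (a, b)" using idx_inj[of p q] ij(1) ab(1) pq(3) by auto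
    moreover have "A i j a b > 0" using gt Ce[OF pq(1,2) ij(1) ab(1)] by simp
    ultimately obtain x y where xy: "1 \<le> x" "x \<le> int N" "1 \<le> y" "y \<le> int N" "(x, y) \<noteq> (a, b)"
      "A x y a b < 0" "Az x y a b = 0" "A i j a b \<le> Az i j x y * A x y a b / A x y x y"
      using positive_entry_path[OF ij(2-5) ab(2-5)] by blast
    obtain r where r: "r < ?n" "idx N r = (x, y)" using idx_surj[OF xy(1-4)] .
    have "r \<noteq> q" using r(2) ab(1) xy(5) by auto
    then have "S $$ (r, q) = A x y a b"
      using Se[OF r(1) pq(2)] Ce[OF r(1) pq(2) r(2) ab(1)] Ze[OF r(1) pq(2) r(2) ab(1)] xy by simp
    then have "C $$ (p, q) \<le> Z $$ (p, r) * S $$ (r, q) / C $$ (r, r)"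
      using xy(8) Ce[OF pq(1,2) ij(1) ab(1)] Ze[OF pq(1) r(1) ij(1) r(2)] Ce[OF r(1) r(1) r(2) r(2)]
      by simp
    \<comment> \<open>All terms of the matrix product are nonnegative, so the single path already
      bounds the entry.\<close>
    also have "\<dots> \<le> (\<Sum>r<?n. Z $$ (p, r) * S $$ (r, q) / C $$ (r, r))"
      using r(1) ZS diag pq
      by (intro member_le_sum) (auto intro!: divide_nonneg_pos mult_nonpos_nonpos)
    finally show ?thesis .
  qed
  have W: "W p > 0" if "p < ?n" for p using simpson_pos by (simp add: W_def split: prod.split)
  have colC: "(\<Sum>p<?n. W p * C $$ (p, q)) > 0" if q: "q < ?n" for q
  proof -
    obtain a b where ab: "idx N q = (a, b)" "1 \<le> a" "a \<le> int N" "1 \<le> b" "b \<le> int N"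
      using idx_cases[OF q] .
    have "(\<Sum>p<?n. W p * C $$ (p, q)) = (\<Sum>p<?n. (\<lambda>(i, j). mu i * mu j * A i j a b) (idx N p))"
      using Ce[OF _ q _ ab(1)] by (intro sum.cong) (auto simp: W_def split: prod.split)
    also have "\<dots> = mu a * mu b * M a b"
      unfolding sum_idx using column_sum_entry[OF ab(2-5)] by simp
    finally show ?thesis using simpson_pos M_pos[OF ab(2-5)] by simp
  qed
  have colZ: "W q * C $$ (q, q) + (\<Sum>p<?n. W p * Z $$ (p, q)) > 0" if q: "q < ?n" for q
  proof -
    obtain a b where ab: "idx N q = (a, b)" "1 \<le> a" "a \<le> int N" "1 \<le> b" "b \<le> int N"
      using idx_cases[OF q] .
    have "(\<Sum>p<?n. W p * Z $$ (p, q)) = (\<Sum>p<?n. (\<lambda>(i, j). mu i * mu j * Az i j a b) (idx N p))"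
      using Ze[OF _ q _ ab(1)] by (intro sum.cong) (auto simp: W_def split: prod.split)
    also have "\<dots> = (\<Sum>i\<in>{1..int N}. \<Sum>j\<in>{1..int N}. mu i * mu j * Az i j a b)"
      unfolding sum_idx by simp
    finally show ?thesis
      using column_sum_z[OF ab(2-5)] Ce[OF q q ab(1) ab(1)] by (simp add: W_def ab(1))
  qed
  note L = lorenz_column_weights[OF C n Z S_def diag ZS(1) ZS(2) pos W colC colZ]
  show "lorenz_conditions C" by (rule L(1))
  show "\<exists>P Q. P \<in> carrier_mat (N * N) (N * N) \<and> Q \<in> carrier_mat (N * N) (N * N)
      \<and> M_matrix P \<and> M_matrix Q \<and> C = P * Q" by (rule L(2))
  show "monotone_mat C" by (rule L(3))
qed

end

section \<open>From the data to the grid\<close>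

text \<open>The derivative bound is asked for only between \<open>x\<close> and \<open>y\<close>, so
  that a gradient bound on one block is enough.\<close>

lemma interval_mean_value_bound:
  fixes f f' :: "real \<Rightarrow> real"
  assumes der: "\<And>x. x \<in> {l..r} \<Longrightarrow> (f has_real_derivative f' x) (at x within {l..r})"
    and xy: "x \<in> {l..r}" "y \<in> {l..r}"
    and bound: "\<And>z. min x y \<le> z \<Longrightarrow> z \<le> max x y \<Longrightarrow> \<bar>f' z\<bar> \<le> B"
  shows "\<bar>f y - f x\<bar> \<le> B * \<bar>y - x\<bar>"
proof -
  have sub: "{min x y..max x y} \<subseteq> {l..r}" using xy by auto
  have "norm (f y - f x) \<le> B * norm (y - x)"
  proof (rule field_differentiable_bound[of "{min x y..max x y}" f f'])
    show "(f has_field_derivative f' z) (at z within {min x y..max x y})" if "z \<in> {min x y..max x y}" for z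
      using der sub that by (blast intro: DERIV_subset)
  qed (use bound in auto)
  then show ?thesis by simp
qed

text \<open>A mirror image is never farther from a grid point than the ghost point itself, so bounds
  for ghost values follow from grid values in the same block.\<close>

lemma reflect_grid:
  assumes "N \<ge> 3" "1 \<le> i" "i \<le> int N" "\<bar>s\<bar> \<le> 2"
  shows "1 \<le> reflect N (i + s)" "reflect N (i + s) \<le> int N" "\<bar>reflect N (i + s) - i\<bar> \<le> \<bar>s\<bar>"
  using assms by (auto simp: reflect_def)

lemma grid_coord_bounds:
  assumes "h = L / real k" "N = 2 * k + 1" "k \<ge> 1" "L > 0" "1 \<le> i" "i \<le> int N"
  shows "grid_coord L h i \<in> {- L..L}"
proof -
  have h: "h > 0" using assms by simp
  have "(of_int i - 1) * h \<le> (2 * real k) * h"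
    using assms h by (intro mult_right_mono) auto
  also have "\<dots> = 2 * L" using assms by simp
  finally show ?thesis using assms h by (simp add: grid_coord_def)
qed

lemma grid_coord_mono: "h > 0 \<Longrightarrow> i \<le> j \<Longrightarrow> grid_coord L h i \<le> grid_coord L h j"
  by (simp add: grid_coord_def)

lemma grid_coord_diff: "h > 0 \<Longrightarrow> \<bar>grid_coord L h i - grid_coord L h j\<bar> = \<bar>of_int (i - j)\<bar> * h"
proof -
  assume "h > 0"
  have "grid_coord L h i - grid_coord L h j = of_int (i - j) * h"
    by (simp add: grid_coord_def algebra_simps)
  then show ?thesis using \<open>h > 0\<close> by (simp add: abs_mult)
qed

lemma finite_grid_block: "finite (grid_block N i j)"
  by (auto simp: grid_block_def intro: finite_subset)

theorem theorem3p7: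
  fixes k N :: nat and L h D \<Delta>t \<epsilon>0 :: real
    and \<M> \<M>x \<M>y :: "real \<times> real \<Rightarrow> real"
    and vel :: "real \<times> real \<Rightarrow> real \<times> real"
    and M u v :: "int \<Rightarrow> int \<Rightarrow> real"
    and A :: "real mat"
  assumes "k \<ge> 1" and "N = 2 * k + 1" and "L > 0" and "h = L / real k"
    and "D > 0" and "\<Delta>t > 0"
    and "C1_closed_square L \<M> \<M>x \<M>y"
    and "\<epsilon>0 > 0" and "\<And>p. p \<in> dom_square L \<Longrightarrow> \<M> p \<ge> \<epsilon>0"
    and M_def: "M = even_ext N (\<lambda>i j. \<M> (grid_point L h i j))"
    and u_def: "u = (\<lambda>i j. odd_ext N (\<lambda>a. fst (vel (grid_point L h a j))) i)"
    and v_def: "v = (\<lambda>i j. odd_ext N (\<lambda>b. snd (vel (grid_point L h i b))) j)"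
    and no_flux_u: "\<And>j. j \<in> {1..int N} \<Longrightarrow> u 1 j = 0 \<and> u (int N) j = 0"
    and no_flux_v: "\<And>i. i \<in> {1..int N} \<Longrightarrow> v i 1 = 0 \<and> v i (int N) = 0"
    and b: "\<And>i j. i \<in> {1..int N} \<Longrightarrow> j \<in> {1..int N} \<Longrightarrow>
      h * Max ((\<lambda>(a, b). norm (u a b, v a b)) ` grid_block N i j)
        \<le> 1 / 20 * D * Min ((\<lambda>(a, b). M a b) ` grid_block N i j)"
    and c: "\<And>i j. i \<in> {1..int N} \<Longrightarrow> j \<in> {1..int N} \<Longrightarrow>
      h * (SUP p\<in>closed_block L h i j. norm (\<M>x p, \<M>y p))
        \<le> sqrt 2 / 320 * Min ((\<lambda>(a, b). M a b) ` grid_block N i j)"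
    and d: "\<Delta>t / h^2 \<ge> 1 / (sqrt 2 * D)"
    and A_def: "A = coeff_mat N h D \<Delta>t M u v"
  shows
    "((\<forall>i\<in>{1..int N}. \<forall>j\<in>{1..int N}.
         (odd i \<and> odd j \<longrightarrow>
            M i j + \<Delta>t * conv_odd h (\<lambda>a. u a j) i + \<Delta>t * conv_odd h (\<lambda>b. v i b) j > 0) \<and>
         (odd i \<and> even j \<longrightarrow>
            M i j + \<Delta>t * (D * (M i (j-1) + M i (j+1)) / h^2) + \<Delta>t * conv_odd h (\<lambda>a. u a j) i > 0) \<and>
         (even i \<and> odd j \<longrightarrow>
            M i j + \<Delta>t * (D * (M (i-1) j + M (i+1) j) / h^2) + \<Delta>t * conv_odd h (\<lambda>b. v i b) j > 0))
      \<longrightarrow> lorenz_conditions A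
          \<and> (\<exists>P Q. P \<in> carrier_mat (N * N) (N * N) \<and> Q \<in> carrier_mat (N * N) (N * N)
               \<and> M_matrix P \<and> M_matrix Q \<and> A = P * Q)
          \<and> monotone_mat A)
     \<and>
     ((\<forall>i\<in>{1..int N}. \<forall>j\<in>{1..int N}.
         (odd i \<and> odd j \<longrightarrow> conv_odd h (\<lambda>a. u a j) i + conv_odd h (\<lambda>b. v i b) j = 0) \<and>
         (odd i \<and> even j \<longrightarrow> conv_odd h (\<lambda>a. u a j) i + conv_even h (\<lambda>b. v i b) j = 0) \<and>
         (even i \<and> odd j \<longrightarrow> conv_even h (\<lambda>a. u a j) i + conv_odd h (\<lambda>b. v i b) j = 0) \<and>
         (even i \<and> even j \<longrightarrow> conv_even h (\<lambda>a. u a j) i + conv_even h (\<lambda>b. v i b) j = 0))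
      \<longrightarrow> monotone_mat A)"
proof -
  have N: "odd N" "N \<ge> 3" using assms(1,2) by auto
  have h: "h > 0" using assms(1,3,4) by simp
  note coord = grid_coord_bounds[OF assms(4,2,1,3)]
  have Mval: "M i j = \<M> (grid_point L h i j)" if "1 \<le> i" "i \<le> int N" "1 \<le> j" "j \<le> int N" for i j
    using that by (simp add: M_def even_ext_def reflect_def)
  have Mrefl: "M i j = M (reflect N i) j" "M i j = M i (reflect N j)"
    if "-1 \<le> i" "i \<le> int N + 2" "-1 \<le> j" "j \<le> int N + 2" for i j
    using that N by (auto simp: M_def even_ext_def reflect_def)
  have Mpos: "M i j > 0" if "1 \<le> i" "i \<le> int N" "1 \<le> j" "j \<le> int N" for i j
  proof -
    have "grid_point L h i j \<in> dom_square L"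
      using coord that by (simp add: grid_point_def dom_square_def)
    then show ?thesis using assms(8,9) Mval[OF that] by (smt (verit))
  qed
  have Min_le: "Min ((\<lambda>(a, b). M a b) ` grid_block N i j) \<le> M i j"
    if "1 \<le> i" "i \<le> int N" "1 \<le> j" "j \<le> int N" for i j
    by (rule Min_le) (use that in \<open>auto simp: finite_grid_block grid_block_def image_iff intro!: bexI[of _ "(i, j)"]\<close>)
  have grad: "h * norm (\<M>x p, \<M>y p) \<le> grad_tol * M i j"
    if ij: "1 \<le> i" "i \<le> int N" "1 \<le> j" "j \<le> int N" and p: "p \<in> closed_block L h i j" for i j p
  proof -
    \<comment> \<open>Boundedness of the gradient has to be secured before the supremum in (c) may
      serve as an upper bound.\<close>
    have "continuous_on (dom_square L) (\<lambda>p. norm (\<M>x p, \<M>y p))"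
      using assms(7) unfolding C1_closed_square_def by (intro continuous_intros) auto
    moreover have "compact (dom_square L)"
      unfolding dom_square_def by (intro compact_Times compact_Icc)
    ultimately have "bdd_above ((\<lambda>p. norm (\<M>x p, \<M>y p)) ` dom_square L)"
      by (intro bounded_imp_bdd_above compact_imp_bounded compact_continuous_image)
    then have "bdd_above ((\<lambda>p. norm (\<M>x p, \<M>y p)) ` closed_block L h i j)"
      by (rule bdd_above_mono) (auto simp: closed_block_def)
    then have "norm (\<M>x p, \<M>y p) \<le> (SUP p\<in>closed_block L h i j. norm (\<M>x p, \<M>y p))"
      using p by (intro cSUP_upper)
    then have "h * norm (\<M>x p, \<M>y p) \<le> h * (SUP p\<in>closed_block L h i j. norm (\<M>x p, \<M>y p))"
      using h by (intro mult_left_mono) auto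
    also have "\<dots> \<le> sqrt 2 / 320 * Min ((\<lambda>(a, b). M a b) ` grid_block N i j)"
      using c ij by simp
    also have "\<dots> \<le> sqrt 2 / 320 * M i j"
      using Min_le[OF ij] by (intro mult_left_mono) auto
    also have "\<dots> \<le> grad_tol * M i j"
    proof (intro mult_right_mono)
      \<comment> \<open>This bound gives \<open>grad_tol\<close> exactly, as 1.44 / 320 =
        9/2000.\<close>
      have "sqrt 2 \<le> 144 / 100" by (rule real_le_lsqrt) (simp_all add: power2_eq_square)
      then show "sqrt 2 / 320 \<le> grad_tol" by (simp add: grad_tol_def)
    qed (use Mpos[OF ij] in simp)
    finally show ?thesis .
  qed
  have near_x: "\<bar>M (i + s) j - M i j\<bar> \<le> \<bar>of_int s\<bar> * grad_tol * M i j"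
    if ij: "1 \<le> i" "i \<le> int N" "1 \<le> j" "j \<le> int N" and s: "\<bar>s\<bar> \<le> 2" for i j s
  proof -
    \<comment> \<open>A ghost value is the value at the mirror index \<open>i'\<close>. The segment
      from \<open>i\<close> to \<open>i'\<close> stays in the block of \<open>i\<close>, and the
      spacing in its length cancels the \<open>h\<close> of condition (c).\<close>
    define i' where "i' = reflect N (i + s)"
    have i': "1 \<le> i'" "i' \<le> int N" "\<bar>i' - i\<bar> \<le> \<bar>s\<bar>"
      unfolding i'_def using reflect_grid[OF N(2) ij(1,2) s] by auto
    let ?x = "grid_coord L h i" and ?x' = "grid_coord L h i'" and ?y = "grid_coord L h j"
    have "\<bar>\<M> (?x', ?y) - \<M> (?x, ?y)\<bar> \<le> (grad_tol * M i j / h) * \<bar>?x' - ?x\<bar>"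
    proof (rule interval_mean_value_bound[where f = "\<lambda>s. \<M> (s, ?y)" and f' = "\<lambda>s. \<M>x (s, ?y)"])
      show "((\<lambda>s. \<M> (s, ?y)) has_real_derivative \<M>x (z, ?y)) (at z within {-L..L})" if "z \<in> {-L..L}" for z
        using assms(7) that coord[OF ij(3,4)] by (simp add: C1_closed_square_def)
      show "\<bar>\<M>x (z, ?y)\<bar> \<le> grad_tol * M i j / h" if z: "min ?x ?x' \<le> z" "z \<le> max ?x ?x'" for z
      proof -
        have "grid_coord L h (i - 2) \<le> ?x" "grid_coord L h (i - 2) \<le> ?x'"
          "?x \<le> grid_coord L h (i + 2)" "?x' \<le> grid_coord L h (i + 2)"
          "grid_coord L h (j - 2) \<le> ?y" "?y \<le> grid_coord L h (j + 2)"
          using i' s by (auto intro!: grid_coord_mono[OF h])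
        then have "(z, ?y) \<in> closed_block L h i j"
          using z coord[OF ij(1,2)] coord[OF ij(3,4)] coord[OF i'(1,2)]
          by (auto simp: closed_block_def dom_square_def min_def max_def split: if_splits)
        from grad[OF ij this] have "norm (\<M>x (z, ?y), \<M>y (z, ?y)) \<le> grad_tol * M i j / h"
          using h by (simp add: pos_le_divide_eq mult.commute)
        moreover have "\<bar>\<M>x (z, ?y)\<bar> \<le> norm (\<M>x (z, ?y), \<M>y (z, ?y))"
          using norm_fst_le[of "\<M>x (z, ?y)" "\<M>y (z, ?y)"] by simp
        ultimately show ?thesis by linarith
      qed
    qed (use coord[OF ij(1,2)] coord[OF i'(1,2)] in auto)
    also have "\<dots> = grad_tol * M i j * \<bar>of_int (i' - i)\<bar>"
      unfolding grid_coord_diff[OF h] using h by simp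
    also have "\<dots> \<le> grad_tol * M i j * \<bar>of_int s\<bar>"
      using i'(3) Mpos[OF ij] by (intro mult_left_mono) (auto simp: grad_tol_def)
    finally have "\<bar>M i' j - M i j\<bar> \<le> \<bar>of_int s\<bar> * grad_tol * M i j"
      using Mval i' ij by (simp add: grid_point_def mult_ac)
    moreover have "M (i + s) j = M i' j"
      unfolding i'_def using Mrefl(1)[of "i + s" j] ij s by auto
    ultimately show ?thesis by simp
  qed
  have near_y: "\<bar>M i (j + s) - M i j\<bar> \<le> \<bar>of_int s\<bar> * grad_tol * M i j"
    if ij: "1 \<le> i" "i \<le> int N" "1 \<le> j" "j \<le> int N" and s: "\<bar>s\<bar> \<le> 2" for i j s
  proof -
    define j' where "j' = reflect N (j + s)"
    have j': "1 \<le> j'" "j' \<le> int N" "\<bar>j' - j\<bar> \<le> \<bar>s\<bar>"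
      unfolding j'_def using reflect_grid[OF N(2) ij(3,4) s] by auto
    let ?x = "grid_coord L h i" and ?y' = "grid_coord L h j'" and ?y = "grid_coord L h j"
    have "\<bar>\<M> (?x, ?y') - \<M> (?x, ?y)\<bar> \<le> (grad_tol * M i j / h) * \<bar>?y' - ?y\<bar>"
    proof (rule interval_mean_value_bound[where f = "\<lambda>s. \<M> (?x, s)" and f' = "\<lambda>s. \<M>y (?x, s)"])
      show "((\<lambda>s. \<M> (?x, s)) has_real_derivative \<M>y (?x, z)) (at z within {-L..L})" if "z \<in> {-L..L}" for z
        using assms(7) that coord[OF ij(1,2)] by (simp add: C1_closed_square_def)
      show "\<bar>\<M>y (?x, z)\<bar> \<le> grad_tol * M i j / h" if z: "min ?y ?y' \<le> z" "z \<le> max ?y ?y'" for z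
      proof -
        have "grid_coord L h (j - 2) \<le> ?y" "grid_coord L h (j - 2) \<le> ?y'"
          "?y \<le> grid_coord L h (j + 2)" "?y' \<le> grid_coord L h (j + 2)"
          "grid_coord L h (i - 2) \<le> ?x" "?x \<le> grid_coord L h (i + 2)"
          using j' s by (auto intro!: grid_coord_mono[OF h])
        then have "(?x, z) \<in> closed_block L h i j"
          using z coord[OF ij(1,2)] coord[OF ij(3,4)] coord[OF j'(1,2)]
          by (auto simp: closed_block_def dom_square_def min_def max_def split: if_splits)
        from grad[OF ij this] have "norm (\<M>x (?x, z), \<M>y (?x, z)) \<le> grad_tol * M i j / h"
          using h by (simp add: pos_le_divide_eq mult.commute)
        moreover have "\<bar>\<M>y (?x, z)\<bar> \<le> norm (\<M>x (?x, z), \<M>y (?x, z))"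
          using norm_snd_le[of "\<M>y (?x, z)" "\<M>x (?x, z)"] by simp
        ultimately show ?thesis by linarith
      qed
    qed (use coord[OF ij(3,4)] coord[OF j'(1,2)] in auto)
    also have "\<dots> = grad_tol * M i j * \<bar>of_int (j' - j)\<bar>"
      unfolding grid_coord_diff[OF h] using h by simp
    also have "\<dots> \<le> grad_tol * M i j * \<bar>of_int s\<bar>"
      using j'(3) Mpos[OF ij] by (intro mult_left_mono) (auto simp: grad_tol_def)
    finally have "\<bar>M i j' - M i j\<bar> \<le> \<bar>of_int s\<bar> * grad_tol * M i j"
      using Mval j' ij by (simp add: grid_point_def mult_ac)
    moreover have "M i (j + s) = M i j'"
      unfolding j'_def using Mrefl(2)[of i "j + s"] ij s by auto
    ultimately show ?thesis by simp
  qed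
  have speed: "h * norm (u a b, v a b) \<le> D / 20 * M i j"
    if ij: "1 \<le> i" "i \<le> int N" "1 \<le> j" "j \<le> int N"
      and ab: "1 \<le> a" "a \<le> int N" "1 \<le> b" "b \<le> int N" "\<bar>a - i\<bar> \<le> 1" "\<bar>b - j\<bar> \<le> 1" for i j a b
  proof -
    have "(a, b) \<in> grid_block N i j" using ab by (auto simp: grid_block_def)
    then have "norm (u a b, v a b) \<le> Max ((\<lambda>(a, b). norm (u a b, v a b)) ` grid_block N i j)"
      using finite_grid_block by (intro Max_ge) force+
    then have "h * norm (u a b, v a b) \<le> h * Max ((\<lambda>(a, b). norm (u a b, v a b)) ` grid_block N i j)"
      using h by (intro mult_left_mono) auto
    also have "\<dots> \<le> 1 / 20 * D * Min ((\<lambda>(a, b). M a b) ` grid_block N i j)" using b ij by simp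
    also have "\<dots> \<le> 1 / 20 * D * M i j" using Min_le[OF ij] assms(5) by (intro mult_left_mono) auto
    finally show ?thesis by simp
  qed
  have speed_u: "h * \<bar>u a j\<bar> \<le> D / 20 * M i j"
    if ij: "1 \<le> i" "i \<le> int N" "1 \<le> j" "j \<le> int N" and a: "1 \<le> a" "a \<le> int N" "\<bar>a - i\<bar> \<le> 1" for i j a
  proof -
    have "h * \<bar>u a j\<bar> \<le> h * norm (u a j, v a j)"
      using norm_fst_le[of "u a j" "v a j"] h by (intro mult_left_mono) auto
    then show ?thesis using speed[OF ij a(1,2) ij(3,4) a(3)] by simp
  qed
  have speed_v: "h * \<bar>v i b\<bar> \<le> D / 20 * M i j"
    if ij: "1 \<le> i" "i \<le> int N" "1 \<le> j" "j \<le> int N" and b: "1 \<le> b" "b \<le> int N" "\<bar>b - j\<bar> \<le> 1" for i j b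
  proof -
    have "h * \<bar>v i b\<bar> \<le> h * norm (u i b, v i b)"
      using norm_snd_le[of "v i b" "u i b"] h by (intro mult_left_mono) auto
    then show ?thesis using speed[OF ij ij(1,2) b(1,2) _ b(3)] by simp
  qed
  have odd_ghost: "odd_ext N w 0 = - odd_ext N w 2" "odd_ext N w (-1) = - odd_ext N w 3"
    "odd_ext N w (int N + 1) = - odd_ext N w (int N - 1)"
    "odd_ext N w (int N + 2) = - odd_ext N w (int N - 2)" for w
    using N by (simp_all add: odd_ext_def reflect_def)
  have step: "h^2 \<le> sqrt 2 * \<Delta>t * D"
    using d h assms(5) by (simp add: field_simps)
  have line_x: "scheme_line N h D (\<lambda>i. M i j) (\<lambda>i. u i j)" if j: "1 \<le> j" "j \<le> int N" for j
  proof
    show "M 0 j = M 2 j" "M (-1) j = M 3 j" "M (int N + 1) j = M (int N - 1) j"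
      "M (int N + 2) j = M (int N - 2) j"
      using N by (simp_all add: M_def even_ext_def reflect_def)
    show "u 0 j = - u 2 j" "u (-1) j = - u 3 j" "u (int N + 1) j = - u (int N - 1) j"
      "u (int N + 2) j = - u (int N - 2) j"
      unfolding u_def by (rule odd_ghost)+
  qed (use N h assms(5) no_flux_u Mpos near_x speed_u j in auto)
  have line_y: "scheme_line N h D (\<lambda>j. M i j) (\<lambda>j. v i j)" if i: "1 \<le> i" "i \<le> int N" for i
  proof
    show "M i 0 = M i 2" "M i (-1) = M i 3" "M i (int N + 1) = M i (int N - 1)"
      "M i (int N + 2) = M i (int N - 2)"
      using N by (simp_all add: M_def even_ext_def reflect_def)
    show "v i 0 = - v i 2" "v i (-1) = - v i 3" "v i (int N + 1) = - v i (int N - 1)"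
      "v i (int N + 2) = - v i (int N - 2)"
      unfolding v_def by (rule odd_ghost)+
  qed (use N h assms(5) no_flux_v Mpos near_y speed_v i in auto)
  have "scheme_grid N h D \<Delta>t M u v"
    using line_x line_y assms(6) step N(2) by (rule scheme_grid.intro)
  from scheme_grid.lorenz[OF this] show ?thesis unfolding A_def by blast
qed

end
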